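(* Let $(M,\mathscr{L})$ be a pseudo-Finsler space modeled on a pseudo-Minkowski space $(V,L)$, with local vierbein $e^a_\mu(x)$ and commutation coefficients $c^a{}_{bc}(x)$. Then the spray is $$G^\mu=\tfrac12\,e^\mu_l\Big(g^{lk}y_q y^n c^q{}_{kn}+e^l_{\delta,\rho}\,e^\delta_s e^\rho_p\, y^s y^p\Big),$$ and the coefficients of the non-linear connection are $$N^\mu_\alpha=e^\mu_l e^b_\alpha\Big[e^l_{\rho,\eta}e^\eta_b e^\rho_p y^p+c^q{}_{kn}\Big(-C^{lk}_b\,y_q y^n+\tfrac12\big(g^{lk}g_{qb}y^n+g^{lk}y_q\delta^n_b+\delta^l_q\delta^k_b y^n\big)\Big)\Big].$$
   Context: Einstein's summation convention is used. A pseudo-Minkowski space is a pair $(V,L)$ where $V$ is an $m$-dimensional real vector space and $L\colon\bar\omega\to\mathbb{R}$ is defined on the closure of an open cone $\omega\subset V$ with vertex the origin, with $L\in C^4(\omega)\cap C^0(\bar\omega)$, $L(sy)=s^2L(y)$ for $s>0$, and non-degenerate Hessian on $\omega$. A pseudo-Finsler space is a pair $(M,\mathscr{L})$, $\dim M=m$, $\mathscr{L}\colon\bar\Omega\to\mathbb{R}$, $\Omega\subset TM$ projecting onto $M$, such that each $(T_xM,\mathscr{L}_x)$, with $\mathscr{L}_x$ the restriction of $\mathscr{L}$ to the fibre (cone $\Omega_x=\Omega\cap T_xM$), is a pseudo-Minkowski space with signature independent of $x$. It is modeled on $(V,L)$ if locally, for $x\in U\subset M$, there are linear isomorphisms $\varphi_x\colon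 T_xM\to V$, sufficiently differentiable in $x$, with $\varphi_x(\Omega_x)=\omega$ and $L(\varphi_x(y))=\mathscr{L}_x(y)$. Fix a basis $\{\tilde e_a\}$ of $V$ and put $e_a=\varphi_x^{-1}(\tilde e_a)=e^\mu_a\partial_\mu$, with dual basis $e^a=e^a_\mu dx^\mu$ (the vierbein), in local coordinates $x^\mu$ of $M$. A tangent vector is $y=y^\mu\partial_\mu=y^ae_a$, $y^\mu=y^ae^\mu_a$; regarding $L$ as a function of $(y^a)$, $\mathscr{L}(x^\mu,y^\nu)=L(e^a_\nu(x)y^\nu)$. A comma denotes partial derivative with respect to the base coordinates: $e^a_{\mu,\nu}=\partial e^a_\mu/\partial x^\nu$. The commutation coefficients are defined by $[e_a,e_b]=c^c{}_{ab}e_c$, i.e. $c^c{}_{ab}=e^\alpha_ae^\beta_b(e^c_{\alpha,\beta}-e^c_{\beta,\alpha})$. With $\partial_a=\partial/\partial y^a$: $y_a=\partial_aL$, $g_{ab}=\partial_a\partial_bL$, $g^{ab}$ the inverse of $g_{ab}$, $C_{abc}=\frac12\partial_a\partial_b\partial_cL$; indices of $C$ are raised with $g^{ab}$, so $C^{lk}_b=g^{la}g^{kc}C_{acb}$. These depend only on $(y^a)$. With $g_{\mu\nu}=\partial^2\mathscr{L}/\partial y^\mu\partial y^\nu$ and inverse $g^{\mu\nu}$, the spray is $G^\mu:=\frac12g^{\mu\sigma}\big(\frac{\partial^2\mathscr{L}}{\partial x^\rho\partial y^\sigma}y^\rho-\frac{\partial\mathscr{L}}{\partial x^\sigma}\big)$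 and $N^\mu_\alpha:=\partial G^\mu/\partial y^\alpha$ (partial derivatives in the variables $(x^\mu,y^\nu)$). *)

theory Defs
  imports "HOL-Analysis.Analysis"
begin

section \<open>Differential calculus\<close>

text \<open>\<open>Ck_on k S f\<close>: \<open>f\<close> is of class \<open>C\<^sup>k\<close> on \<open>S\<close>. It is only applied to open sets \<open>S\<close>.\<close>

fun Ck_on :: "nat \<Rightarrow> 'a::euclidean_space set \<Rightarrow> ('a \<Rightarrow> 'b::real_normed_vector) \<Rightarrow> bool" where
  "Ck_on 0 S f \<longleftrightarrow> continuous_on S f"
| "Ck_on (Suc k) S f \<longleftrightarrow>
     (\<forall>x\<in>S. f differentiable (at x)) \<and> (\<forall>u. Ck_on k S (\<lambda>x. frechet_derivative f (at x) u))"

definition pd :: "'m::finite \<Rightarrow> (real^'m \<Rightarrow> real) \<Rightarrow> real^'m \<Rightarrow> real" where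
  "pd i f x = frechet_derivative f (at x) (axis i 1)"

definition hess :: "('v::euclidean_space \<Rightarrow> real) \<Rightarrow> 'v \<Rightarrow> 'v \<Rightarrow> 'v \<Rightarrow> real" where
  "hess L y u v = frechet_derivative (\<lambda>z. frechet_derivative L (at z) u) (at y) v"

definition lie_bracket ::
  "(real^'m::finite \<Rightarrow> real^'m) \<Rightarrow> (real^'m \<Rightarrow> real^'m) \<Rightarrow> real^'m \<Rightarrow> real^'m" where
  "lie_bracket X Y x = frechet_derivative Y (at x) (X x) - frechet_derivative X (at x) (Y x)"

section \<open>Pseudo-Minkowski spaces\<close>

text \<open>\<open>L\<close> is a total function; only its values on \<open>closure \<omega>\<close> are meaningful. The inner product of
  \<open>'v\<close> plays no role beyond fixing the vector space topology.\<close>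

definition pseudo_Minkowski :: "'v::euclidean_space set \<Rightarrow> ('v \<Rightarrow> real) \<Rightarrow> bool" where
  "pseudo_Minkowski \<omega> L \<longleftrightarrow>
     open \<omega> \<and> (\<forall>y\<in>\<omega>. \<forall>s>0. s *\<^sub>R y \<in> \<omega>) \<and>
     Ck_on 4 \<omega> L \<and> continuous_on (closure \<omega>) L \<and>
     (\<forall>y\<in>closure \<omega>. \<forall>s>0. L (s *\<^sub>R y) = s\<^sup>2 * L y) \<and>
     (\<forall>y\<in>\<omega>. \<forall>u. (\<forall>v. hess L y u v = 0) \<longrightarrow> u = 0)"

text \<open>Pairs (positive index, negative index). Since \<open>\<omega>\<close> is not required to be connected, the
  signature is recorded as the set of all signatures that the Hessian takes on \<open>\<omega>\<close>.\<close>

definition signature :: "'v::euclidean_space set \<Rightarrow> ('v \<Rightarrow> real) \<Rightarrow> (nat \<times> nat) set" where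
  "signature \<omega> L =
     (\<lambda>y. (Max {dim S | S. subspace S \<and> (\<forall>u\<in>S. u \<noteq> 0 \<longrightarrow> hess L y u u > 0)},
           Max {dim S | S. subspace S \<and> (\<forall>u\<in>S. u \<noteq> 0 \<longrightarrow> hess L y u u < 0)})) ` \<omega>"

section \<open>Smooth manifolds and their tangent spaces\<close>

text \<open>A chart is a pair of its domain and its coordinate map; the values of the latter outside the
  domain are irrelevant.\<close>

type_synonym ('p, 'm) chart = "'p set \<times> ('p \<Rightarrow> real^'m)"

definition point_of :: "('p, 'm) chart \<Rightarrow> real^'m \<Rightarrow> 'p" where
  "point_of c x = inv_into (fst c) (snd c) x"

definition smooth_atlas ::
  "('p::{t2_space,second_countable_topology}, 'm::finite) chart set \<Rightarrow> bool" where
  "smooth_atlas A \<longleftrightarrow>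
     (\<forall>c\<in>A. open (fst c) \<and> open (snd c ` fst c) \<and>
        homeomorphism (fst c) (snd c ` fst c) (snd c) (point_of c)) \<and>
     (\<forall>c\<in>A. \<forall>c'\<in>A. \<forall>k. Ck_on k (snd c ` (fst c \<inter> fst c')) (snd c' \<circ> point_of c))"

definition carrier_of :: "('p, 'm) chart set \<Rightarrow> 'p set" where
  "carrier_of A = (\<Union>c\<in>A. fst c)"

text \<open>Derivative at \<open>p\<close> of the coordinate change from \<open>c\<close> to \<open>c'\<close>.\<close>

definition transition ::
  "('p, 'm::finite) chart \<Rightarrow> ('p, 'm) chart \<Rightarrow> 'p \<Rightarrow> real^'m \<Rightarrow> real^'m" where
  "transition c c' p = frechet_derivative (snd c' \<circ> point_of c) (at (snd c p))"

text \<open>A tangent vector at \<open>p\<close> is the family of its coordinate representations, one for every chart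
  around \<open>p\<close>, related by the transformation law of contravariant vectors. Families are normalised
  to zero at all other charts.\<close>

type_synonym ('p, 'm) tvec = "('p, 'm) chart \<Rightarrow> real^'m"

definition tangent_space ::
  "('p, 'm::finite) chart set \<Rightarrow> 'p \<Rightarrow> ('p, 'm) tvec set" where
  "tangent_space A p = {v.
     (\<forall>c\<in>A. \<forall>c'\<in>A. p \<in> fst c \<and> p \<in> fst c' \<longrightarrow> v c' = transition c c' p (v c)) \<and>
     (\<forall>c. \<not> (c \<in> A \<and> p \<in> fst c) \<longrightarrow> v c = 0)}"

definition tangent_bundle ::
  "('p, 'm::finite) chart set \<Rightarrow> ('p \<times> ('p, 'm) tvec) set" where
  "tangent_bundle A = Sigma (carrier_of A) (tangent_space A)"

text \<open>The tangent vector \<open>y\<^sup>\<mu> \<partial>\<^sub>\<mu>\<close> at \<open>p\<close> with respect to the chart \<open>c\<close>.\<close>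

definition coord_vec ::
  "('p, 'm::finite) chart set \<Rightarrow> ('p, 'm) chart \<Rightarrow> 'p \<Rightarrow> real^'m \<Rightarrow> ('p, 'm) tvec" where
  "coord_vec A c p y = (\<lambda>c'. if c' \<in> A \<and> p \<in> fst c' then transition c c' p y else 0)"

definition linear_iso_on :: "('p, 'm::finite) tvec set \<Rightarrow> (('p, 'm) tvec \<Rightarrow> 'v::real_vector) \<Rightarrow> bool" where
  "linear_iso_on T f \<longleftrightarrow> bij_betw f T UNIV \<and>
     (\<forall>v\<in>T. \<forall>w\<in>T. f (\<lambda>c. v c + w c) = f v + f w) \<and>
     (\<forall>r. \<forall>v\<in>T. f (\<lambda>c. r *\<^sub>R v c) = r *\<^sub>R f v)"

section \<open>Pseudo-Finsler spaces\<close>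

definition coord_cone ::
  "('p, 'm::finite) chart set \<Rightarrow> ('p \<times> ('p, 'm) tvec) set \<Rightarrow> ('p, 'm) chart \<Rightarrow> real^'m \<Rightarrow> (real^'m) set" where
  "coord_cone A \<Omega> c x = {y. (point_of c x, coord_vec A c (point_of c x) y) \<in> \<Omega>}"

definition coord_fun ::
  "('p, 'm::finite) chart set \<Rightarrow> ('p \<times> ('p, 'm) tvec \<Rightarrow> real) \<Rightarrow> ('p, 'm) chart \<Rightarrow>
     real^'m \<Rightarrow> real^'m \<Rightarrow> real" where
  "coord_fun A F c x y = F (point_of c x, coord_vec A c (point_of c x) y)"

text \<open>Being pseudo-Minkowski and having a given signature are invariant under linear isomorphisms,
  so for a tangent space they are expressed through its identification with \<open>\<real>\<^sup>m\<close> given by a chart.\<close>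

definition pseudo_Finsler ::
  "('p::{t2_space,second_countable_topology}, 'm::finite) chart set \<Rightarrow> ('p \<times> ('p, 'm) tvec) set \<Rightarrow>
     ('p \<times> ('p, 'm) tvec \<Rightarrow> real) \<Rightarrow> bool" where
  "pseudo_Finsler A \<Omega> F \<longleftrightarrow>
     smooth_atlas A \<and> \<Omega> \<subseteq> tangent_bundle A \<and> fst ` \<Omega> = carrier_of A \<and>
     (\<forall>c\<in>A. \<forall>x\<in>snd c ` fst c. pseudo_Minkowski (coord_cone A \<Omega> c x) (coord_fun A F c x)) \<and>
     (\<forall>c\<in>A. \<forall>x\<in>snd c ` fst c. \<forall>c'\<in>A. \<forall>x'\<in>snd c' ` fst c'.
        signature (coord_cone A \<Omega> c x) (coord_fun A F c x) =
        signature (coord_cone A \<Omega> c' x') (coord_fun A F c' x'))"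

text \<open>A family \<open>\<phi>\<^sub>p\<close>, \<open>p \<in> U\<close>, of linear isomorphisms identifying the fibres over \<open>U\<close> with \<open>(V, L)\<close>;
  its dependence on \<open>p\<close> is required to be \<open>C\<^sup>1\<close> (the components \<open>\<phi>\<^sub>p(\<partial>\<^sub>\<mu>)\<close> are \<open>C\<^sup>1\<close> in every chart).
  The condition \<open>\<phi> p v \<in> closure \<omega>\<close> says that \<open>v\<close> lies in the closure of \<open>\<Omega>\<^sub>p\<close>.\<close>

definition model_triv ::
  "('p::{t2_space,second_countable_topology}, 'm::finite) chart set \<Rightarrow> ('p \<times> ('p, 'm) tvec) set \<Rightarrow>
     ('p \<times> ('p, 'm) tvec \<Rightarrow> real) \<Rightarrow> 'v::euclidean_space set \<Rightarrow> ('v \<Rightarrow> real) \<Rightarrow>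
     'p set \<Rightarrow> ('p \<Rightarrow> ('p, 'm) tvec \<Rightarrow> 'v) \<Rightarrow> bool" where
  "model_triv A \<Omega> F \<omega> L U \<phi> \<longleftrightarrow>
     open U \<and> U \<subseteq> carrier_of A \<and>
     (\<forall>p\<in>U. linear_iso_on (tangent_space A p) (\<phi> p) \<and>
        \<phi> p ` {v. (p, v) \<in> \<Omega>} = \<omega> \<and>
        (\<forall>v\<in>tangent_space A p. \<phi> p v \<in> closure \<omega> \<longrightarrow> L (\<phi> p v) = F (p, v))) \<and>
     (\<forall>c\<in>A. \<forall>\<mu>. Ck_on 1 (snd c ` (U \<inter> fst c))
        (\<lambda>x. \<phi> (point_of c x) (coord_vec A c (point_of c x) (axis \<mu> 1))))"

definition modeled_on ::
  "('p::{t2_space,second_countable_topology}, 'm::finite) chart set \<Rightarrow> ('p \<times> ('p, 'm) tvec) set \<Rightarrow>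
     ('p \<times> ('p, 'm) tvec \<Rightarrow> real) \<Rightarrow> 'v::euclidean_space set \<Rightarrow> ('v \<Rightarrow> real) \<Rightarrow> bool" where
  "modeled_on A \<Omega> F \<omega> L \<longleftrightarrow>
     (\<forall>p\<in>carrier_of A. \<exists>U \<phi>. p \<in> U \<and> model_triv A \<Omega> F \<omega> L U \<phi>)"

section \<open>The vierbein\<close>

definition is_basis :: "('m::finite \<Rightarrow> 'v::real_vector) \<Rightarrow> bool" where
  "is_basis B \<longleftrightarrow> inj B \<and> independent (range B) \<and> span (range B) = UNIV"

text \<open>The vector field \<open>e\<^sub>a = \<phi>\<inverse>(B a)\<close> in the chart \<open>c\<close>: \<open>frame A \<phi> B c a x $ \<mu>\<close> is \<open>e\<^sup>\<mu>\<^sub>a(x)\<close>.\<close>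

definition frame ::
  "('p, 'm::finite) chart set \<Rightarrow> ('p \<Rightarrow> ('p, 'm) tvec \<Rightarrow> 'v) \<Rightarrow> ('m \<Rightarrow> 'v) \<Rightarrow>
     ('p, 'm) chart \<Rightarrow> 'm \<Rightarrow> real^'m \<Rightarrow> real^'m" where
  "frame A \<phi> B c a x =
     inv_into (tangent_space A (point_of c x)) (\<phi> (point_of c x)) (B a) c"

text \<open>The dual basis: \<open>coframe A \<phi> B c a \<mu> x\<close> is \<open>e\<^sup>a\<^sub>\<mu>(x)\<close>, the inverse matrix of \<open>e\<^sup>\<mu>\<^sub>a(x)\<close>.\<close>

definition coframe ::
  "('p, 'm::finite) chart set \<Rightarrow> ('p \<Rightarrow> ('p, 'm) tvec \<Rightarrow> 'v) \<Rightarrow> ('m \<Rightarrow> 'v) \<Rightarrow>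
     ('p, 'm) chart \<Rightarrow> 'm \<Rightarrow> 'm \<Rightarrow> real^'m \<Rightarrow> real" where
  "coframe A \<phi> B c a \<mu> x = matrix_inv (\<chi> \<nu> b. frame A \<phi> B c b x $ \<nu>) $ a $ \<mu>"

section \<open>Tensors derived from a function of the fibre components\<close>

definition in_basis :: "('m::finite \<Rightarrow> 'v::real_vector) \<Rightarrow> ('v \<Rightarrow> real) \<Rightarrow> real^'m \<Rightarrow> real" where
  "in_basis B L w = L (\<Sum>a\<in>UNIV. w $ a *\<^sub>R B a)"

definition fund_tensor :: "(real^'m::finite \<Rightarrow> real) \<Rightarrow> 'm \<Rightarrow> 'm \<Rightarrow> real^'m \<Rightarrow> real" where
  "fund_tensor l a b w = pd a (pd b l) w"

definition inv_metric :: "(real^'m::finite \<Rightarrow> real) \<Rightarrow> 'm \<Rightarrow> 'm \<Rightarrow> real^'m \<Rightarrow> real" where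
  "inv_metric l a b w = matrix_inv (\<chi> i j. fund_tensor l i j w) $ a $ b"

definition cartan :: "(real^'m::finite \<Rightarrow> real) \<Rightarrow> 'm \<Rightarrow> 'm \<Rightarrow> 'm \<Rightarrow> real^'m \<Rightarrow> real" where
  "cartan l a b c w = (1/2) * pd a (pd b (pd c l)) w"

text \<open>\<open>cartan_up l i k b\<close> is \<open>C\<^sup>i\<^sup>k\<^sub>b\<close>.\<close>

definition cartan_up :: "(real^'m::finite \<Rightarrow> real) \<Rightarrow> 'm \<Rightarrow> 'm \<Rightarrow> 'm \<Rightarrow> real^'m \<Rightarrow> real" where
  "cartan_up l i k b w =
     (\<Sum>a\<in>UNIV. \<Sum>c\<in>UNIV. inv_metric l i a w * inv_metric l k c w * cartan l a c b w)"

section \<open>Spray and non-linear connection\<close>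

text \<open>Here \<open>F x y\<close> is the Finsler function in local coordinates \<open>(x\<^sup>\<mu>, y\<^sup>\<nu>)\<close> of the tangent bundle.\<close>

definition spray :: "(real^'m::finite \<Rightarrow> real^'m \<Rightarrow> real) \<Rightarrow> 'm \<Rightarrow> real^'m \<Rightarrow> real^'m \<Rightarrow> real" where
  "spray F \<mu> x y = (1/2) * (\<Sum>\<sigma>\<in>UNIV. inv_metric (F x) \<mu> \<sigma> y *
     ((\<Sum>\<rho>\<in>UNIV. pd \<rho> (\<lambda>x'. pd \<sigma> (F x') y) x * y $ \<rho>) - pd \<sigma> (\<lambda>x'. F x' y) x))"

definition nonlinear_connection ::
  "(real^'m::finite \<Rightarrow> real^'m \<Rightarrow> real) \<Rightarrow> 'm \<Rightarrow> 'm \<Rightarrow> real^'m \<Rightarrow> real^'m \<Rightarrow> real" where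
  "nonlinear_connection F \<mu> \<alpha> x y = pd \<alpha> (\<lambda>y'. spray F \<mu> x y') y"

end

theory Submission
  imports Defs
begin

text \<open>In the coordinates of a chart the Finsler function is \<open>F z v = f (E z *v v)\<close>, where \<open>E\<close> is the
  matrix of the coframe and \<open>f\<close> is \<open>L\<close> in the basis \<open>B\<close>. The chain rule expresses the derivatives in
  the spray through those of \<open>f\<close> and \<open>E\<close>. The terms with the metric of \<open>f\<close> cancel against its
  inverse; what is left of the others is the curl \<open>e\<^sup>a\<^sub>\<mu>\<^sub>,\<^sub>\<nu> - e\<^sup>a\<^sub>\<nu>\<^sub>,\<^sub>\<mu>\<close>, whose components in the frame are the
  commutation coefficients because \<open>d(E\<inverse>) = - E\<inverse> dE E\<inverse>\<close>. The spray formula holds on a whole open set of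
  fibre vectors, so it may be differentiated along the fibre; the Cartan tensor enters through the
  derivative of the inverse metric.\<close>

section \<open>Partial derivatives\<close>

text \<open>The locale \<open>modeled_coordinates\<close> knows only a matrix field
  \<open>E\<close>, an open set of components and a function \<open>f\<close>;
  \<open>modeled_chart\<close> shows that a chart of the manifold supplies them. So the index
  calculus never meets a tangent bundle. The formula for \<open>F\<close> is available only where
  \<open>E z *v v\<close> lies in the cone. Each derivative is therefore taken on a neighbourhood
  where it holds, in the fibre with \<open>z\<close> fixed or in the base with \<open>v\<close>
  fixed. The coframe is only \<open>C^1\<close>. This suffices: each term of the spray contains a
  single derivative in the base, and the connection differentiates the spray in the fibre alone.
  Iterated derivatives such as \<open>pd a (pd b f)\<close> have a definite order, so index symmetry
  of the metric and the Cartan tensor is a theorem about \<open>C^2\<close> functions, proved here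
  for iterated Frechet derivatives. In the connection, the factor 1/2 vanishes from the quadratic
  term and the term with two Kronecker deltas appears for one reason: the coefficients e^l_{rho,eta}
  of the quadratic form are not symmetric, and half of their curl is left over.\<close>

lemma frechet_derivative_cong_open:
  assumes "open X" "x \<in> X" "\<And>z. z \<in> X \<Longrightarrow> f z = g z"
  shows "frechet_derivative f (at x) = frechet_derivative g (at x)"
proof -
  \<comment> \<open>\<open>frechet_derivative\<close> is a choice from the set of derivatives. The
    two sets coincide, so the choices agree even at a point without a derivative.\<close>
  have "(f has_derivative f') (at x) \<longleftrightarrow> (g has_derivative f') (at x)" for f'
    using assms by (metis has_derivative_transform_within_open)
  then show ?thesis
    by (simp add: frechet_derivative_def)
qed

lemma differentiable_cong_open:
  assumes "f differentiable (at x)" "open X" "x \<in> X" "\<And>z. z \<in> X \<Longrightarrow> f z = g z"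
  shows "g differentiable (at x)"
  using assms unfolding differentiable_def by (metis has_derivative_transform_within_open)

lemma pd_cong_open:
  assumes "open X" "x \<in> X" "\<And>z. z \<in> X \<Longrightarrow> f z = g z"
  shows "pd i f x = pd i g x"
  unfolding pd_def using frechet_derivative_cong_open[OF assms] by simp

lemma pd_eqI: "(f has_derivative f') (at x) \<Longrightarrow> pd i f x = f' (axis i 1)"
  unfolding pd_def using frechet_derivative_at by metis

lemma frechet_derivative_eq_sum_pd:
  assumes "f differentiable (at x)"
  shows "frechet_derivative f (at x) h = (\<Sum>j\<in>UNIV. h $ j * pd j f x)"
proof -
  have "frechet_derivative f (at x) h =
      frechet_derivative f (at x) (\<Sum>j\<in>UNIV. h $ j *\<^sub>R axis j 1)"
    by (simp add: basis_expansion scalar_mult_eq_scaleR[symmetric])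
  also have "\<dots> = (\<Sum>j\<in>UNIV. h $ j * pd j f x)"
    using linear_frechet_derivative[OF assms] by (simp add: linear_sum linear_cmul pd_def)
  finally show ?thesis .
qed

lemma differentiable_vec:
  fixes G :: "'a::real_normed_vector \<Rightarrow> real^'n"
  assumes "\<And>j. (\<lambda>z. G z $ j) differentiable (at x)"
  shows "G differentiable (at x)"
proof -
  have "(\<lambda>z. \<Sum>j\<in>UNIV. G z $ j *\<^sub>R (axis j 1 :: real^'n)) differentiable (at x)"
    using assms by (intro differentiable_sum differentiable_scaleR) auto
  then show ?thesis
    by (simp add: basis_expansion scalar_mult_eq_scaleR[symmetric])
qed

lemma frechet_derivative_vec_nth:
  fixes G :: "'a::real_normed_vector \<Rightarrow> real^'n"
  assumes "G differentiable (at x)"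
  shows "((\<lambda>z. G z $ j) has_derivative (\<lambda>h. frechet_derivative G (at x) h $ j)) (at x)"
  using assms frechet_derivative_works bounded_linear.has_derivative[OF bounded_linear_vec_nth]
  by blast

lemma differentiable_vec_nth:
  fixes G :: "'a::real_normed_vector \<Rightarrow> real^'n"
  assumes "G differentiable (at x)"
  shows "(\<lambda>z. G z $ j) differentiable (at x)"
  using frechet_derivative_vec_nth[OF assms] differentiable_def by blast

lemma pd_add:
  assumes "f differentiable (at x)" "g differentiable (at x)"
  shows "pd i (\<lambda>z. f z + g z) x = pd i f x + pd i g x"
  using has_derivative_add[OF assms[unfolded frechet_derivative_works], THEN pd_eqI]
  by (simp add: pd_def)

lemma pd_mult:
  assumes "f differentiable (at x)" "g differentiable (at x)"
  shows "pd i (\<lambda>z. f z * g z) x = f x * pd i g x + pd i f x * g x"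
  using has_derivative_mult[OF assms[unfolded frechet_derivative_works], THEN pd_eqI]
  by (simp add: pd_def)

lemma pd_const [simp]: "pd i (\<lambda>z. k) x = 0"
  by (simp add: pd_def)

lemma pd_sum:
  assumes "\<And>j. j \<in> J \<Longrightarrow> f j differentiable (at x)"
  shows "pd i (\<lambda>z. \<Sum>j\<in>J. f j z) x = (\<Sum>j\<in>J. pd i (f j) x)"
  using has_derivative_sum[of J f "\<lambda>j. frechet_derivative (f j) (at x)" "at x", THEN pd_eqI] assms
  by (simp add: pd_def frechet_derivative_works)

lemma pd_cmult:
  assumes "f differentiable (at x)"
  shows "pd i (\<lambda>z. k * f z) x = k * pd i f x"
  using pd_mult[of "\<lambda>z. k" x f i] assms by simp

lemma pd_mult_const:
  assumes "f differentiable (at x)"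
  shows "pd i (\<lambda>z. f z * k) x = pd i f x * k"
  using pd_mult[of f x "\<lambda>z. k" i] assms by simp

lemma pd_vec_nth: "pd i (\<lambda>z. z $ j) x = (if i = j then 1 else 0)"
  by (subst pd_eqI[OF bounded_linear_imp_has_derivative[OF bounded_linear_vec_nth]])
    (auto simp: axis_def)

lemma
  fixes G :: "real^'m \<Rightarrow> real^'n"
  assumes "f differentiable (at (G x))" "\<And>j. (\<lambda>z. G z $ j) differentiable (at x)"
  shows pd_chain: "pd i (\<lambda>z. f (G z)) x = (\<Sum>j\<in>UNIV. pd j f (G x) * pd i (\<lambda>z. G z $ j) x)"
    and differentiable_chain_vec: "(\<lambda>z. f (G z)) differentiable (at x)"
proof -
  have G: "G differentiable (at x)"
    using assms(2) by (rule differentiable_vec)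
  show "(\<lambda>z. f (G z)) differentiable (at x)"
    using differentiable_chain_at[OF G assms(1)] by (simp add: o_def)
  have "pd i (\<lambda>z. f (G z)) x =
      frechet_derivative f (at (G x)) (frechet_derivative G (at x) (axis i 1))"
    using frechet_derivative_compose[OF G assms(1)] by (simp add: pd_def o_def)
  also have "\<dots> = (\<Sum>j\<in>UNIV. frechet_derivative G (at x) (axis i 1) $ j * pd j f (G x))"
    by (rule frechet_derivative_eq_sum_pd[OF assms(1)])
  also have "\<dots> = (\<Sum>j\<in>UNIV. pd j f (G x) * pd i (\<lambda>z. G z $ j) x)"
    by (simp add: pd_eqI[OF frechet_derivative_vec_nth[OF G]] mult.commute)
  finally show "pd i (\<lambda>z. f (G z)) x = (\<Sum>j\<in>UNIV. pd j f (G x) * pd i (\<lambda>z. G z $ j) x)" .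
qed

lemma differentiable_matrix_vector_nth:
  fixes T :: "real^'m^'n"
  shows "(\<lambda>v. (T *v v) $ j) differentiable (at v)"
  by (intro bounded_linear_imp_differentiable bounded_linear_compose[OF bounded_linear_vec_nth]
      matrix_vector_mul_bounded_linear)

lemma pd_matrix_vector_nth:
  fixes T :: "real^'m^'n"
  shows "pd i (\<lambda>v. (T *v v) $ j) v = T $ j $ i"
proof -
  have "pd i (\<lambda>v. (T *v v) $ j) v = (T *v axis i 1) $ j"
    by (rule pd_eqI) (auto intro!: bounded_linear_imp_has_derivative
        bounded_linear_compose[OF bounded_linear_vec_nth] matrix_vector_mul_bounded_linear)
  then show ?thesis
    by (simp add: matrix_vector_mul_component inner_axis row_def matrix_vector_mult_def axis_def if_distrib cong: if_cong)
qed

lemma pd_comp_matrix: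
  fixes T :: "real^'m^'n"
  assumes "f differentiable (at (T *v v))"
  shows "pd i (\<lambda>v. f (T *v v)) v = (\<Sum>j\<in>UNIV. pd j f (T *v v) * T $ j $ i)"
  by (simp add: pd_chain[where G = "\<lambda>v. T *v v", OF assms differentiable_matrix_vector_nth]
      pd_matrix_vector_nth)

lemma differentiable_comp_matrix:
  fixes T :: "real^'m^'n" and f :: "real^'n \<Rightarrow> real"
  assumes "f differentiable (at (T *v v))"
  shows "(\<lambda>v. f (T *v v)) differentiable (at v)"
  by (rule differentiable_chain_vec[where G = "\<lambda>v. T *v v"])
    (use assms in \<open>simp_all add: differentiable_matrix_vector_nth\<close>)

section \<open>Functions of class \<open>C\<^sup>k\<close>\<close>

lemma Ck_on_Suc_pd: "Ck_on (Suc k) S f \<Longrightarrow> Ck_on k S (pd i f)"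
  by (simp add: pd_def[abs_def])

lemma Ck_on_differentiable: "Ck_on (Suc k) S f \<Longrightarrow> z \<in> S \<Longrightarrow> f differentiable (at z)"
  by simp

lemma Ck_on_SucD: "Ck_on (Suc k) S f \<Longrightarrow> Ck_on k S f"
proof (induction k arbitrary: f)
  case 0
  then show ?case
    by (auto intro!: continuous_at_imp_continuous_on differentiable_imp_continuous_within)
next
  case (Suc k)
  then show ?case
    by (meson Ck_on.simps(2))
qed

lemma Ck_on_mono: "j \<le> k \<Longrightarrow> Ck_on k S f \<Longrightarrow> Ck_on j S f"
proof (induction k rule: dec_induct)
  case (step n)
  from Ck_on_SucD[OF step.prems] show ?case
    by (rule step.IH)
qed

lemma Ck_on_cong_open:
  assumes "open S" "\<And>z. z \<in> S \<Longrightarrow> f z = g z" "Ck_on k S f"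
  shows "Ck_on k S g"
  using assms(2,3)
proof (induction k arbitrary: f g)
  case 0
  then show ?case
    using continuous_on_cong by fastforce
next
  case (Suc k)
  have "\<forall>u. Ck_on k S (\<lambda>x. frechet_derivative g (at x) u)"
  proof
    fix u
    have "frechet_derivative f (at x) u = frechet_derivative g (at x) u" if "x \<in> S" for x
      using frechet_derivative_cong_open[OF assms(1) that Suc.prems(1)] by simp
    then show "Ck_on k S (\<lambda>x. frechet_derivative g (at x) u)"
      using Suc.IH Suc.prems(2) by force
  qed
  moreover have "\<forall>x\<in>S. g differentiable (at x)"
    using differentiable_cong_open[OF _ assms(1) _ Suc.prems(1)] Suc.prems(2) by auto
  ultimately show ?case
    by simp
qed

lemma
  fixes \<beta> :: "'a::euclidean_space \<Rightarrow> 'b::euclidean_space"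
  assumes "linear \<beta>" "f differentiable (at (\<beta> x))"
  shows differentiable_comp_linear: "(\<lambda>z. f (\<beta> z)) differentiable (at x)"
    and frechet_derivative_comp_linear:
      "frechet_derivative (\<lambda>z. f (\<beta> z)) (at x) h = frechet_derivative f (at (\<beta> x)) (\<beta> h)"
proof -
  have \<beta>: "(\<beta> has_derivative \<beta>) (at x)"
    using assms(1) by (simp add: linear_linear bounded_linear_imp_has_derivative)
  have D: "((\<lambda>z. f (\<beta> z)) has_derivative (\<lambda>h. frechet_derivative f (at (\<beta> x)) (\<beta> h))) (at x)"
    using diff_chain_at[OF \<beta> assms(2)[unfolded frechet_derivative_works]] by (simp add: o_def)
  then show "(\<lambda>z. f (\<beta> z)) differentiable (at x)"
    by (auto simp: differentiable_def)
  show "frechet_derivative (\<lambda>z. f (\<beta> z)) (at x) h = frechet_derivative f (at (\<beta> x)) (\<beta> h)"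
    using fun_cong[OF frechet_derivative_at[OF D], of h] by simp
qed

text \<open>For a linear inner map the derivative along \<open>u\<close> is again a composite,
  namely of the derivative of \<open>f\<close> along \<open>\<beta> u\<close> with
  \<open>\<beta>\<close>. The induction thus closes without a product rule. It carries the
  regularity of \<open>L\<close> over to components in a basis.\<close>

lemma Ck_on_comp_linear:
  fixes \<beta> :: "'a::euclidean_space \<Rightarrow> 'b::euclidean_space"
  assumes "open S" "linear \<beta>" "Ck_on k S f"
  shows "Ck_on k (\<beta> -` S) (\<lambda>z. f (\<beta> z))"
  using assms(3)
proof (induction k arbitrary: f)
  case 0
  then show ?case
    using continuous_on_compose2[of S f "\<beta> -` S" \<beta>] linear_continuous_on[of \<beta> "\<beta> -` S"] assms(2)
    by (simp add: linear_linear)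
next
  case (Suc k)
  have f: "f differentiable (at (\<beta> x))" if "x \<in> \<beta> -` S" for x
    using Suc.prems that by simp
  have "Ck_on k (\<beta> -` S) (\<lambda>x. frechet_derivative (\<lambda>z. f (\<beta> z)) (at x) u)" for u
  proof (rule Ck_on_cong_open)
    show "open (\<beta> -` S)"
      using assms(1,2) by (simp add: open_vimage linear_continuous_on linear_linear)
    show "Ck_on k (\<beta> -` S) (\<lambda>x. frechet_derivative f (at (\<beta> x)) (\<beta> u))"
      using Suc.IH[of "\<lambda>x. frechet_derivative f (at x) (\<beta> u)"] Suc.prems by simp
    show "frechet_derivative f (at (\<beta> z)) (\<beta> u) = frechet_derivative (\<lambda>z. f (\<beta> z)) (at z) u"
      if "z \<in> \<beta> -` S" for z
      by (rule frechet_derivative_comp_linear[OF assms(2) f[OF that], symmetric])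
  qed
  then show ?case
    using differentiable_comp_linear[OF assms(2) f] by simp
qed

text \<open>Both iterated derivatives are limits of the same second difference quotient
  \<open>(f (x + hu + hv) - f (x + hu) - f (x + hv) + f x) / h\<^sup>2\<close>.\<close>

lemma Ck_on_second_difference:
  fixes f :: "'a::euclidean_space \<Rightarrow> real"
  assumes S: "open S" "Ck_on 2 S f" and h: "h > 0"
    and sub: "\<And>s t. 0 \<le> s \<Longrightarrow> s \<le> h \<Longrightarrow> 0 \<le> t \<Longrightarrow> t \<le> h \<Longrightarrow> x + s *\<^sub>R u + t *\<^sub>R v \<in> S"
  shows "\<exists>s t. 0 < s \<and> s < h \<and> 0 < t \<and> t < h \<and>
    f (x + h *\<^sub>R u + h *\<^sub>R v) - f (x + h *\<^sub>R u) - f (x + h *\<^sub>R v) + f x =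
      h\<^sup>2 * frechet_derivative (\<lambda>z. frechet_derivative f (at z) u) (at (x + s *\<^sub>R u + t *\<^sub>R v)) v"
proof -
  define fu where "fu = (\<lambda>z. frechet_derivative f (at z) u)"
  have C: "Ck_on (Suc (Suc 0)) S f"
    using S(2) by (simp add: numeral_2_eq_2)
  have f: "(f has_derivative frechet_derivative f (at z)) (at z)" if "z \<in> S" for z
    using C that by (auto simp: frechet_derivative_works)
  have fu: "(fu has_derivative frechet_derivative fu (at z)) (at z)" if "z \<in> S" for z
    using C that unfolding fu_def by (auto simp: frechet_derivative_works)
  have ray: "((\<lambda>s. g (a + s *\<^sub>R d)) has_real_derivative frechet_derivative g (at (a + s *\<^sub>R d)) d) (at s)"
    if g: "(g has_derivative frechet_derivative g (at (a + s *\<^sub>R d))) (at (a + s *\<^sub>R d))"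
    for g :: "'a \<Rightarrow> real" and a d s
  proof -
    have 1: "((\<lambda>s. a + s *\<^sub>R d) has_derivative (\<lambda>t. t *\<^sub>R d)) (at s)"
      by (auto intro!: derivative_eq_intros)
    have "linear (frechet_derivative g (at (a + s *\<^sub>R d)))"
      using g has_derivative_linear by blast
    with diff_chain_at[OF 1 g] show ?thesis
      by (simp add: o_def has_field_derivative_def linear_cmul mult_commute_abs)
  qed
  \<comment> \<open>The second difference is the increment over \<open>[0, h]\<close> of a first
    difference in direction \<open>v\<close>, taken as a function of the step along
    \<open>u\<close>. One mean value in \<open>s\<close> and then one in \<open>t\<close> give the
    intermediate point.\<close>
  define \<psi> where "\<psi> = (\<lambda>s. f ((x + h *\<^sub>R v) + s *\<^sub>R u) - f (x + s *\<^sub>R u))"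
  have \<psi>': "(\<psi> has_real_derivative fu ((x + h *\<^sub>R v) + s *\<^sub>R u) - fu (x + s *\<^sub>R u)) (at s)"
    if "0 \<le> s" "s \<le> h" for s
    unfolding \<psi>_def fu_def using sub[of s h] sub[of s 0] that h
    by (intro DERIV_diff ray f) (auto simp: add_ac)
  obtain s where s: "0 < s" "s < h"
    and s_eq: "\<psi> h - \<psi> 0 = (h - 0) * (fu ((x + h *\<^sub>R v) + s *\<^sub>R u) - fu (x + s *\<^sub>R u))"
    using MVT2[OF h, of \<psi> "\<lambda>s. fu ((x + h *\<^sub>R v) + s *\<^sub>R u) - fu (x + s *\<^sub>R u)"] \<psi>' by blast
  have fu': "((\<lambda>t. fu ((x + s *\<^sub>R u) + t *\<^sub>R v)) has_real_derivative
      frechet_derivative fu (at ((x + s *\<^sub>R u) + t *\<^sub>R v)) v) (at t)" if "0 \<le> t" "t \<le> h" for t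
    using sub[of s t] that s by (intro ray fu) auto
  obtain t where t: "0 < t" "t < h"
    and t_eq: "fu ((x + s *\<^sub>R u) + h *\<^sub>R v) - fu ((x + s *\<^sub>R u) + 0 *\<^sub>R v) =
      (h - 0) * frechet_derivative fu (at ((x + s *\<^sub>R u) + t *\<^sub>R v)) v"
    using MVT2[OF h, of "\<lambda>t. fu ((x + s *\<^sub>R u) + t *\<^sub>R v)"
        "\<lambda>t. frechet_derivative fu (at ((x + s *\<^sub>R u) + t *\<^sub>R v)) v"] fu' by blast
  have "f (x + h *\<^sub>R u + h *\<^sub>R v) - f (x + h *\<^sub>R u) - f (x + h *\<^sub>R v) + f x = \<psi> h - \<psi> 0"
    by (simp add: \<psi>_def add_ac)
  also have "\<dots> = h * (fu ((x + s *\<^sub>R u) + h *\<^sub>R v) - fu ((x + s *\<^sub>R u) + 0 *\<^sub>R v))"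
    by (simp add: s_eq add_ac)
  also have "\<dots> = h\<^sup>2 * frechet_derivative fu (at (x + s *\<^sub>R u + t *\<^sub>R v)) v"
    unfolding t_eq by (simp add: power2_eq_square)
  finally show ?thesis
    using s t unfolding fu_def by blast
qed

lemma Ck_on_2_symmetric:
  fixes f :: "'a::euclidean_space \<Rightarrow> real"
  assumes S: "open S" "x \<in> S" and C: "Ck_on 2 S f"
  shows "frechet_derivative (\<lambda>z. frechet_derivative f (at z) u) (at x) v =
    frechet_derivative (\<lambda>z. frechet_derivative f (at z) v) (at x) u"
proof (rule ccontr)
  define D where "D = (\<lambda>u v z. frechet_derivative (\<lambda>z. frechet_derivative f (at z) u) (at z) v)"
  assume "\<not> ?thesis"
  then have ne: "D u v x \<noteq> D v u x"
    by (simp add: D_def)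
  \<comment> \<open>Half the gap: the intervals of this radius around \<open>D u v x\<close> and
    \<open>D v u x\<close> are disjoint. A single small \<open>h\<close> then yields the
    contradiction, and no limit has to be taken.\<close>
  define \<epsilon> where "\<epsilon> = \<bar>D u v x - D v u x\<bar> / 2"
  have \<epsilon>: "\<epsilon> > 0"
    using ne by (simp add: \<epsilon>_def)
  have cont: "continuous_on S (D u v)" for u v
    using C by (simp add: numeral_2_eq_2 D_def)
  have "\<exists>d>0. \<forall>z\<in>ball x d. \<bar>D u v z - D u v x\<bar> < \<epsilon>" for u v
  proof -
    have "isCont (D u v) x"
      using cont S continuous_on_eq_continuous_at by blast
    then show ?thesis
      using \<epsilon> by (fastforce simp: continuous_at_eps_delta dist_real_def dist_commute)
  qed
  then obtain d1 d2 where d1: "d1 > 0" "\<And>z. z \<in> ball x d1 \<Longrightarrow> \<bar>D u v z - D u v x\<bar> < \<epsilon>"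
    and d2: "d2 > 0" "\<And>z. z \<in> ball x d2 \<Longrightarrow> \<bar>D v u z - D v u x\<bar> < \<epsilon>"
    by metis
  obtain d0 where d0: "d0 > 0" "ball x d0 \<subseteq> S"
    using S openE by blast
  define d where "d = min d0 (min d1 d2)"
  have d: "d > 0" "d \<le> d0" "d \<le> d1" "d \<le> d2"
    using d0 d1 d2 by (auto simp: d_def)
  \<comment> \<open>This scale keeps the whole parallelogram spanned by \<open>h *\<^sub>R u\<close>
    and \<open>h *\<^sub>R v\<close> inside the ball; the summand 1 covers \<open>u = v = 0\<close>
    and makes the bound strict.\<close>
  define h where "h = d / (norm u + norm v + 1)"
  have pos: "norm u + norm v + 1 > 0"
    by (smt (verit) norm_ge_zero)
  have h: "h > 0"
    using d pos by (simp add: h_def)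
  have in_ball: "x + s *\<^sub>R u + t *\<^sub>R v \<in> ball x d" if "0 \<le> s" "s \<le> h" "0 \<le> t" "t \<le> h" for s t
  proof -
    have "norm (s *\<^sub>R u + t *\<^sub>R v) \<le> s * norm u + t * norm v"
      using norm_triangle_ineq[of "s *\<^sub>R u" "t *\<^sub>R v"] that by simp
    also have "\<dots> \<le> h * norm u + h * norm v"
      using that by (intro add_mono mult_right_mono) auto
    also have "\<dots> < h * (norm u + norm v + 1)"
      using h by (simp add: algebra_simps)
    also have "\<dots> = d"
      using pos by (simp add: h_def)
    finally have "dist (x + (s *\<^sub>R u + t *\<^sub>R v)) x < d"
      by (simp add: dist_norm)
    then show ?thesis
      by (simp add: dist_commute add.assoc)
  qed
  have "\<exists>s t. 0 < s \<and> s < h \<and> 0 < t \<and> t < h \<and>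
      f (x + h *\<^sub>R u + h *\<^sub>R v) - f (x + h *\<^sub>R u) - f (x + h *\<^sub>R v) + f x =
        h\<^sup>2 * D u v (x + s *\<^sub>R u + t *\<^sub>R v)"
    unfolding D_def
    by (rule Ck_on_second_difference[OF S(1) C h])
      (use in_ball d d0 in \<open>meson in_mono subset_ball\<close>)
  then obtain s t where st: "0 < s" "s < h" "0 < t" "t < h"
    and eq1: "f (x + h *\<^sub>R u + h *\<^sub>R v) - f (x + h *\<^sub>R u) - f (x + h *\<^sub>R v) + f x =
        h\<^sup>2 * D u v (x + s *\<^sub>R u + t *\<^sub>R v)"
    by blast
  \<comment> \<open>The second difference is symmetric in \<open>u\<close> and \<open>v\<close>, so
    exchanging them evaluates the same number through the other iterated derivative, in general at
    another point.\<close>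
  have "\<exists>s t. 0 < s \<and> s < h \<and> 0 < t \<and> t < h \<and>
      f (x + h *\<^sub>R v + h *\<^sub>R u) - f (x + h *\<^sub>R v) - f (x + h *\<^sub>R u) + f x =
        h\<^sup>2 * D v u (x + s *\<^sub>R v + t *\<^sub>R u)"
    unfolding D_def
  proof (rule Ck_on_second_difference[OF S(1) C h])
    fix s t assume "0 \<le> s" "s \<le> h" "0 \<le> t" "t \<le> h"
    then have "x + t *\<^sub>R u + s *\<^sub>R v \<in> S"
      using in_ball d d0 by (meson in_mono subset_ball)
    then show "x + s *\<^sub>R v + t *\<^sub>R u \<in> S"
      by (simp add: add_ac)
  qed
  then obtain s' t' where st': "0 < s'" "s' < h" "0 < t'" "t' < h"
    and eq2: "f (x + h *\<^sub>R v + h *\<^sub>R u) - f (x + h *\<^sub>R v) - f (x + h *\<^sub>R u) + f x =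
        h\<^sup>2 * D v u (x + s' *\<^sub>R v + t' *\<^sub>R u)"
    by blast
  have "h\<^sup>2 * D u v (x + s *\<^sub>R u + t *\<^sub>R v) = h\<^sup>2 * D v u (x + s' *\<^sub>R v + t' *\<^sub>R u)"
    unfolding eq1[symmetric] eq2[symmetric] by (simp add: add_ac)
  then have "D u v (x + s *\<^sub>R u + t *\<^sub>R v) = D v u (x + t' *\<^sub>R u + s' *\<^sub>R v)"
    using h by (simp add: add_ac)
  moreover have "\<bar>D u v (x + s *\<^sub>R u + t *\<^sub>R v) - D u v x\<bar> < \<epsilon>"
    using in_ball[of s t] st d by (intro d1(2)) auto
  moreover have "\<bar>D v u (x + t' *\<^sub>R u + s' *\<^sub>R v) - D v u x\<bar> < \<epsilon>"
    using in_ball[of t' s'] st' d by (intro d2(2)) auto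
  moreover have False if "\<bar>r - p\<bar> < \<bar>p - q\<bar> / 2" "\<bar>r - q\<bar> < \<bar>p - q\<bar> / 2" for p q r :: real
    using that by (auto simp: abs_if split: if_splits)
  ultimately show False
    unfolding \<epsilon>_def by metis
qed

lemma pd_commute:
  assumes "open S" "x \<in> S" "Ck_on 2 S f"
  shows "pd i (pd j f) x = pd j (pd i f) x"
  using Ck_on_2_symmetric[OF assms, of "axis j 1" "axis i 1"] by (simp add: pd_def[abs_def])

section \<open>Differentiation of the inverse matrix\<close>

lemma
  fixes A :: "real^'n^'n"
  assumes "invertible A"
  shows matrix_inv_right: "A ** matrix_inv A = mat 1"
    and matrix_inv_left: "matrix_inv A ** A = mat 1"
  using someI_ex[OF assms[unfolded invertible_def]] by (simp_all add: matrix_inv_def)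

lemma matrix_inv_eqI:
  fixes A :: "real^'n^'n"
  assumes "A ** A' = mat 1"
  shows "matrix_inv A = A'"
proof -
  have "A' ** A = mat 1"
    using assms by (simp add: matrix_left_right_inverse)
  then have inv: "invertible A"
    using assms unfolding invertible_def by blast
  have "matrix_inv A = matrix_inv A ** (A ** A')"
    by (simp add: assms)
  also have "\<dots> = A'"
    using inv by (simp add: matrix_mul_assoc matrix_inv_left)
  finally show ?thesis .
qed

text \<open>Cramer's rule presents the entries as quotients of polynomials in the entries of
  \<open>A\<close>. This gives differentiability of the inverse, which must be known before the
  identity defining the inverse can be differentiated.\<close>

lemma matrix_inv_nth_cramer:
  fixes A :: "real^'n^'n"
  assumes "invertible A"
  shows "matrix_inv A $ i $ j =
    det (\<chi> k l. if l = i then axis j 1 $ k else A $ k $ l) / det A"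
proof -
  have d: "det A \<noteq> 0"
    using assms by (simp add: invertible_det_nz)
  have "A *v (matrix_inv A *v axis j 1) = axis j 1"
    using assms by (simp add: matrix_vector_mul_assoc matrix_inv_right)
  then have "matrix_inv A *v axis j 1 =
      (\<chi> k. det (\<chi> i l. if l = k then axis j 1 $ i else A $ i $ l) / det A)"
    using cramer[OF d] by blast
  then have "(matrix_inv A *v axis j 1) $ i =
      det (\<chi> k l. if l = i then axis j 1 $ k else A $ k $ l) / det A"
    by simp
  then show ?thesis
    by (simp add: matrix_vector_mult_def axis_def if_distrib cong: if_cong)
qed

lemma differentiable_prod:
  fixes f :: "'i \<Rightarrow> 'a::real_normed_vector \<Rightarrow> real"
  assumes "\<And>i. i \<in> I \<Longrightarrow> f i differentiable (at x)"
  shows "(\<lambda>z. \<Prod>i\<in>I. f i z) differentiable (at x)"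
  using assms by (induction I rule: infinite_finite_induct) auto

lemma differentiable_det:
  fixes A :: "'a::real_normed_vector \<Rightarrow> real^'n^'n"
  assumes "\<And>i j. (\<lambda>z. A z $ i $ j) differentiable (at x)"
  shows "(\<lambda>z. det (A z)) differentiable (at x)"
  unfolding det_def
proof (intro differentiable_sum differentiable_mult ballI)
  show "(\<lambda>z. \<Prod>i\<in>UNIV. A z $ i $ p i) differentiable (at x)" for p
    using differentiable_prod[of UNIV "\<lambda>i z. A z $ i $ p i" x] assms by simp
qed simp_all

lemma differentiable_matrix_inv:
  fixes A :: "'a::real_normed_vector \<Rightarrow> real^'n^'n"
  assumes A: "\<And>i j. (\<lambda>z. A z $ i $ j) differentiable (at x)"
    and X: "open X" "x \<in> X" "\<And>z. z \<in> X \<Longrightarrow> invertible (A z)"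
  shows "(\<lambda>z. matrix_inv (A z) $ i $ j) differentiable (at x)"
proof (rule differentiable_cong_open[OF _ X(1,2)])
  show "(\<lambda>z. det (\<chi> k l. if l = i then axis j 1 $ k else A z $ k $ l) / det (A z))
      differentiable (at x)"
  proof (intro differentiable_divide differentiable_det)
    show "(\<lambda>z. (\<chi> k l. if l = i then axis j 1 $ k else A z $ k $ l) $ k $ l) differentiable (at x)"
      for k l
      using A by (cases "l = i") auto
  qed (use A X invertible_det_nz in auto)
qed (simp add: matrix_inv_nth_cramer X(3))

text \<open>The product \<open>matrix_inv (A z) ** A z\<close> is constant near \<open>x\<close>;
  its derivative vanishes, and multiplying by the inverse from the right isolates the derivative of
  the inverse. It serves both for the inverse metric (fibre) and for the frame (base).\<close>

lemma pd_matrix_inv: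
  fixes A :: "real^'m \<Rightarrow> real^'n^'n"
  assumes A: "\<And>i j. (\<lambda>z. A z $ i $ j) differentiable (at x)"
    and X: "open X" "x \<in> X" "\<And>z. z \<in> X \<Longrightarrow> invertible (A z)"
  shows "pd b (\<lambda>z. matrix_inv (A z) $ i $ j) x =
    - (\<Sum>k\<in>UNIV. \<Sum>l\<in>UNIV. matrix_inv (A x) $ i $ k * pd b (\<lambda>z. A z $ k $ l) x * matrix_inv (A x) $ l $ j)"
proof -
  define N where "N = (\<lambda>z. matrix_inv (A z))"
  have N: "(\<lambda>z. N z $ i $ j) differentiable (at x)" for i j
    unfolding N_def using A X by (rule differentiable_matrix_inv)
  define dA where "dA = (\<chi> k l. pd b (\<lambda>z. A z $ k $ l) x)"
  define dN where "dN = (\<chi> k l. pd b (\<lambda>z. N z $ k $ l) x)"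
  have 1: "dN ** A x + N x ** dA = 0"
  proof -
    have "(dN ** A x + N x ** dA) $ k $ l = 0" for k l
    proof -
      have "(dN ** A x + N x ** dA) $ k $ l = pd b (\<lambda>z. \<Sum>m\<in>UNIV. N z $ k $ m * A z $ m $ l) x"
        by (simp add: pd_sum pd_mult N A differentiable_mult matrix_matrix_mult_def dN_def dA_def
            sum.distrib add.commute)
      also have "\<dots> = pd b (\<lambda>z. mat 1 $ k $ l) x"
      proof (rule pd_cong_open[OF X(1,2)])
        fix z assume "z \<in> X"
        then have "N z ** A z = mat 1"
          using X(3) by (simp add: N_def matrix_inv_left)
        then show "(\<Sum>m\<in>UNIV. N z $ k $ m * A z $ m $ l) = mat 1 $ k $ l"
          by (simp add: matrix_matrix_mult_def vec_eq_iff)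
      qed
      finally show ?thesis
        by simp
    qed
    then show ?thesis
      by (simp add: vec_eq_iff)
  qed
  have "dN = dN ** A x ** N x"
    using X by (simp add: N_def matrix_inv_right flip: matrix_mul_assoc)
  also have "\<dots> = - (N x ** dA ** N x)"
  proof -
    have "dN ** A x = - (N x ** dA)"
      using 1 by (simp add: eq_neg_iff_add_eq_0)
    then show ?thesis
      by (simp add: matrix_matrix_mult_def vec_eq_iff sum_negf)
  qed
  finally have "dN $ i $ j = - (N x ** dA ** N x) $ i $ j"
    by simp
  also have "(N x ** dA ** N x) $ i $ j = (\<Sum>k\<in>UNIV. \<Sum>l\<in>UNIV. N x $ i $ k * dA $ k $ l * N x $ l $ j)"
    by (simp add: matrix_matrix_mult_def sum_distrib_right) (rule sum.swap)
  finally show ?thesis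
    by (simp add: dN_def dA_def N_def)
qed

section \<open>Spray and connection of a function modeled on \<open>f\<close> in coordinates\<close>

lemma matrix_vector_mult_nth:
  fixes A :: "real^'n^'m"
  shows "(A *v v) $ i = (\<Sum>j\<in>UNIV. A $ i $ j * v $ j)"
  by (simp add: matrix_vector_mult_def)

lemma transpose_vector_mult_nth:
  fixes A :: "real^'n^'m"
  shows "(transpose A *v v) $ i = (\<Sum>j\<in>UNIV. A $ j $ i * v $ j)"
  by (simp add: matrix_vector_mult_def transpose_def)

text \<open>Intended reading: \<open>W\<close> is the coordinate image of the trivialising set,
  \<open>E z $ a $ \<mu>\<close> is e^a_mu, its inverse has the entries e^mu_a, \<open>S\<close> is
  the cone in components, and \<open>E z *v v\<close> turns coordinate components of a vector into
  frame components.\<close>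

locale modeled_coordinates =
  fixes W :: "(real^'m::finite) set" and E :: "real^'m \<Rightarrow> real^'m^'m"
    and S :: "(real^'m) set" and f :: "real^'m \<Rightarrow> real"
    and F :: "real^'m \<Rightarrow> real^'m \<Rightarrow> real"
  assumes open_W: "open W" and open_S: "open S"
    and E_differentiable: "\<And>z a \<mu>. z \<in> W \<Longrightarrow> (\<lambda>z. E z $ a $ \<mu>) differentiable (at z)"
    and E_invertible: "\<And>z. z \<in> W \<Longrightarrow> invertible (E z)"
    and f_C4: "Ck_on 4 S f"
    and f_nondegenerate: "\<And>w. w \<in> S \<Longrightarrow> invertible (\<chi> i j. fund_tensor f i j w)"
    and F_eq: "\<And>z v. z \<in> W \<Longrightarrow> E z *v v \<in> S \<Longrightarrow> F z v = f (E z *v v)"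
begin

abbreviation M :: "real^'m \<Rightarrow> real^'m^'m" where
  "M z \<equiv> matrix_inv (E z)"

abbreviation metric :: "real^'m \<Rightarrow> real^'m^'m" where
  "metric w \<equiv> \<chi> i j. fund_tensor f i j w"

definition dE :: "real^'m \<Rightarrow> 'm \<Rightarrow> 'm \<Rightarrow> 'm \<Rightarrow> real" where
  "dE x a \<mu> \<nu> = pd \<nu> (\<lambda>z. E z $ a $ \<mu>) x"

definition curl :: "real^'m \<Rightarrow> 'm \<Rightarrow> real^'m^'m" where
  "curl x a = (\<chi> \<mu> \<nu>. dE x a \<mu> \<nu> - dE x a \<nu> \<mu>)"

text \<open>By \<open>commutation_coefficients\<close> below, \<open>K x a $ b $ c\<close> is the commutation coefficient \<open>c\<^sup>a\<^sub>b\<^sub>c\<close> at \<open>x\<close>.\<close>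

definition K :: "real^'m \<Rightarrow> 'm \<Rightarrow> real^'m^'m" where
  "K x a = transpose (M x) ** curl x a ** M x"

subsection \<open>Differentiability and symmetry of the metric\<close>

lemma f_C:
  shows "Ck_on 3 S (pd a f)" "Ck_on 2 S (pd b (pd a f))" "Ck_on 2 S f" "Ck_on 2 S (pd a f)"
  using f_C4 Ck_on_Suc_pd[of 3 S f] Ck_on_Suc_pd[of 2 S "pd a f"]
    Ck_on_mono[of 2 4 S f] Ck_on_mono[of 2 3 S "pd a f"]
  by (auto simp: eval_nat_numeral simp del: Ck_on.simps)

lemma
  assumes "w \<in> S"
  shows f_differentiable: "f differentiable (at w)"
    and pd_f_differentiable: "pd a f differentiable (at w)"
    and fund_tensor_differentiable: "fund_tensor f a b differentiable (at w)"
  using f_C4 f_C(1)[of a] f_C(2)[of a b] assms unfolding fund_tensor_def[abs_def]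
  by (auto simp: eval_nat_numeral)

lemma fund_tensor_commute: "w \<in> S \<Longrightarrow> fund_tensor f a b w = fund_tensor f b a w"
  unfolding fund_tensor_def using pd_commute[OF open_S _ f_C(3)] .

text \<open>The differentiation index has to travel from the outermost place to the last slot of the
  Cartan tensor. It passes \<open>a\<close> by symmetry for \<open>pd c f\<close>, and
  \<open>c\<close> by symmetry for \<open>f\<close>, which holds on all of the open set
  \<open>S\<close> and so may be differentiated.\<close>

lemma pd_fund_tensor:
  assumes "w \<in> S"
  shows "pd b (fund_tensor f a c) w = 2 * cartan f a c b w"
proof -
  have "pd b (fund_tensor f a c) w = pd b (pd a (pd c f)) w"
    by (simp add: fund_tensor_def[abs_def])
  also have "\<dots> = pd a (pd b (pd c f)) w"
    using open_S assms f_C(4) by (rule pd_commute)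
  also have "\<dots> = pd a (pd c (pd b f)) w"
    using open_S assms by (rule pd_cong_open) (rule pd_commute[OF open_S _ f_C(3)])
  finally show ?thesis
    by (simp add: cartan_def)
qed

lemma inv_metric_commute:
  assumes "w \<in> S"
  shows "inv_metric f a b w = inv_metric f b a w"
proof -
  have "transpose (metric w) = metric w"
    using fund_tensor_commute[OF assms] by (simp add: transpose_def vec_eq_iff)
  then have "metric w ** transpose (matrix_inv (metric w)) =
      transpose (matrix_inv (metric w) ** metric w)"
    by (simp add: matrix_transpose_mul)
  also have "\<dots> = mat 1"
    by (simp add: matrix_inv_left f_nondegenerate assms transpose_mat)
  finally have "matrix_inv (metric w) = transpose (matrix_inv (metric w))"
    by (rule matrix_inv_eqI)
  then have "matrix_inv (metric w) $ a $ b = transpose (matrix_inv (metric w)) $ a $ b"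
    by simp
  then show ?thesis
    by (simp add: inv_metric_def transpose_def)
qed

lemma inv_metric_differentiable:
  assumes "w \<in> S"
  shows "inv_metric f i k differentiable (at w)"
  unfolding inv_metric_def[abs_def] using fund_tensor_differentiable[OF assms]
  by (intro differentiable_matrix_inv[OF _ open_S assms f_nondegenerate]) simp_all

text \<open>The minus sign is that of the derivative of an inverse, the 2 cancels the 1/2 in the
  Cartan tensor. Symmetry of the inverse metric brings the raised indices into the order of
  \<open>cartan_up\<close>.\<close>

lemma pd_inv_metric:
  assumes "w \<in> S"
  shows "pd b (inv_metric f i k) w = - 2 * cartan_up f i k b w"
proof -
  have "pd b (inv_metric f i k) w = - (\<Sum>a\<in>UNIV. \<Sum>c\<in>UNIV.
      inv_metric f i a w * pd b (fund_tensor f a c) w * inv_metric f c k w)"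
    using pd_matrix_inv[OF _ open_S assms f_nondegenerate, where b = b and i = i and j = k]
      fund_tensor_differentiable[OF assms]
    by (simp add: inv_metric_def[abs_def])
  also have "\<dots> = - 2 * cartan_up f i k b w"
    by (simp add: pd_fund_tensor[OF assms] cartan_up_def inv_metric_commute[OF assms, of _ k]
        sum_distrib_left sum_negf mult_ac)
  finally show ?thesis .
qed

subsection \<open>Fibre derivatives\<close>

lemma open_fibre: "open {v. E z *v v \<in> S}"
  using open_vimage[OF open_S, of "\<lambda>v. E z *v v"]
  by (simp add: vimage_def linear_continuous_on matrix_vector_mul_bounded_linear)

lemma pd_F:
  assumes "z \<in> W" "E z *v v \<in> S"
  shows "pd \<sigma> (F z) v = (\<Sum>a\<in>UNIV. pd a f (E z *v v) * E z $ a $ \<sigma>)"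
proof -
  have "pd \<sigma> (F z) v = pd \<sigma> (\<lambda>v. f (E z *v v)) v"
    using assms by (intro pd_cong_open[OF open_fibre]) (auto simp: F_eq)
  then show ?thesis
    by (simp add: pd_comp_matrix f_differentiable assms)
qed

lemma fund_tensor_F:
  assumes "z \<in> W" "E z *v v \<in> S"
  shows "(\<chi> i j. fund_tensor (F z) i j v) = transpose (E z) ** metric (E z *v v) ** E z"
proof -
  have "fund_tensor (F z) i j v = (transpose (E z) ** metric (E z *v v) ** E z) $ i $ j" for i j
  proof -
    have "fund_tensor (F z) i j v = pd i (\<lambda>v. \<Sum>a\<in>UNIV. pd a f (E z *v v) * E z $ a $ j) v"
      unfolding fund_tensor_def using assms
      by (intro pd_cong_open[OF open_fibre]) (auto simp: pd_F)
    also have "\<dots> = (\<Sum>a\<in>UNIV. (\<Sum>b\<in>UNIV. fund_tensor f b a (E z *v v) * E z $ b $ i) * E z $ a $ j)"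
      by (simp add: pd_sum pd_mult_const pd_comp_matrix differentiable_comp_matrix
          pd_f_differentiable assms fund_tensor_def)
    also have "\<dots> = (transpose (E z) ** metric (E z *v v) ** E z) $ i $ j"
      by (simp add: matrix_matrix_mult_def transpose_def mult_ac)
    finally show ?thesis .
  qed
  then show ?thesis
    by (simp add: vec_eq_iff)
qed

lemma inv_metric_F:
  assumes "z \<in> W" "E z *v v \<in> S"
  shows "inv_metric (F z) \<mu> \<sigma> v =
    (M z ** matrix_inv (metric (E z *v v)) ** transpose (M z)) $ \<mu> $ \<sigma>"
proof -
  let ?g = "metric (E z *v v)"
  have M: "E z ** M z = mat 1"
    using assms by (simp add: matrix_inv_right E_invertible)
  have "transpose (E z) ** ?g ** E z ** (M z ** matrix_inv ?g ** transpose (M z)) =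
      transpose (E z) ** (?g ** ((E z ** M z) ** matrix_inv ?g)) ** transpose (M z)"
    by (simp add: matrix_mul_assoc)
  also have "\<dots> = transpose (M z ** E z)"
    using assms by (simp add: M matrix_inv_right f_nondegenerate matrix_transpose_mul)
  also have "\<dots> = mat 1"
    using assms by (simp add: matrix_inv_left E_invertible transpose_mat)
  finally show ?thesis
    unfolding inv_metric_def fund_tensor_F[OF assms] by (subst matrix_inv_eqI) auto
qed

subsection \<open>Base derivatives\<close>

lemma E_vec_differentiable:
  assumes "x \<in> W"
  shows "(\<lambda>z. (E z *v v) $ a) differentiable (at x)"
  using E_differentiable[OF assms] by (simp add: matrix_vector_mult_def differentiable_sum)

lemma pd_E_vec:
  assumes "x \<in> W"
  shows "pd \<rho> (\<lambda>z. (E z *v v) $ a) x = (\<Sum>\<nu>\<in>UNIV. dE x a \<nu> \<rho> * v $ \<nu>)"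
  using E_differentiable[OF assms]
  by (simp add: matrix_vector_mult_def dE_def pd_sum pd_mult_const)

text \<open>In a base derivative \<open>v\<close> stays fixed while its frame components
  \<open>E z *v v\<close> move. Continuity of \<open>E\<close> keeps them in the open set
  \<open>S\<close> for \<open>z\<close> near \<open>x\<close>.\<close>

lemma ex_open_base:
  assumes "x \<in> W" "E x *v v \<in> S"
  obtains X where "open X" "x \<in> X" "\<And>z. z \<in> X \<Longrightarrow> z \<in> W \<and> E z *v v \<in> S"
proof -
  have "continuous_on W (\<lambda>z. E z *v v)"
    using E_vec_differentiable
    by (intro continuous_at_imp_continuous_on ballI differentiable_imp_continuous_within
        differentiable_vec) auto
  then have "open ((\<lambda>z. E z *v v) -` S \<inter> W)"
    using continuous_on_open_vimage[OF open_W] open_S by blast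
  then show ?thesis
    using assms that[of "(\<lambda>z. E z *v v) -` S \<inter> W"] by blast
qed

lemma pd_base_comp:
  assumes "x \<in> W" "h differentiable (at (E x *v v))"
  shows "pd \<rho> (\<lambda>z. h (E z *v v)) x =
    (\<Sum>b\<in>UNIV. pd b h (E x *v v) * (\<Sum>\<nu>\<in>UNIV. dE x b \<nu> \<rho> * v $ \<nu>))"
  using pd_chain[where G = "\<lambda>z. E z *v v", OF assms(2) E_vec_differentiable] assms(1)
  by (simp add: pd_E_vec)

lemma pd_base_F:
  assumes "x \<in> W" "E x *v v \<in> S"
  shows "pd \<sigma> (\<lambda>z. F z v) x = (\<Sum>a\<in>UNIV. pd a f (E x *v v) * (\<Sum>\<nu>\<in>UNIV. dE x a \<nu> \<sigma> * v $ \<nu>))"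
proof -
  obtain X where X: "open X" "x \<in> X" "\<And>z. z \<in> X \<Longrightarrow> z \<in> W \<and> E z *v v \<in> S"
    using ex_open_base[OF assms] by blast
  have "pd \<sigma> (\<lambda>z. F z v) x = pd \<sigma> (\<lambda>z. f (E z *v v)) x"
    using X(3) by (intro pd_cong_open[OF X(1,2)]) (simp add: F_eq)
  then show ?thesis
    using assms by (simp add: pd_base_comp f_differentiable)
qed

text \<open>The base point enters \<open>pd \<sigma> (F z) v\<close> twice, through the argument of
  y_a and through the factor e^a_sigma. The product rule gives a metric term and the term y_a
  e^a_{sigma,rho}; only the latter will combine with the base derivative of \<open>F\<close> into
  the curl.\<close>

lemma pd_base_pd_F:
  assumes "x \<in> W" "E x *v v \<in> S"
  shows "pd \<rho> (\<lambda>z. pd \<sigma> (F z) v) x =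
    (\<Sum>a\<in>UNIV. (\<Sum>b\<in>UNIV. fund_tensor f b a (E x *v v) * (\<Sum>\<nu>\<in>UNIV. dE x b \<nu> \<rho> * v $ \<nu>)) * E x $ a $ \<sigma>
      + pd a f (E x *v v) * dE x a \<sigma> \<rho>)"
proof -
  obtain X where X: "open X" "x \<in> X" "\<And>z. z \<in> X \<Longrightarrow> z \<in> W \<and> E z *v v \<in> S"
    using ex_open_base[OF assms] by blast
  have d: "(\<lambda>z. pd a f (E z *v v)) differentiable (at x)" for a
    using differentiable_chain_vec[where G = "\<lambda>z. E z *v v", OF pd_f_differentiable E_vec_differentiable]
      assms by blast
  have "pd \<rho> (\<lambda>z. pd \<sigma> (F z) v) x = pd \<rho> (\<lambda>z. \<Sum>a\<in>UNIV. pd a f (E z *v v) * E z $ a $ \<sigma>) x"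
    using X(3) by (intro pd_cong_open[OF X(1,2)]) (simp add: pd_F)
  also have "\<dots> = (\<Sum>a\<in>UNIV. pd a f (E x *v v) * dE x a \<sigma> \<rho> +
      (\<Sum>b\<in>UNIV. fund_tensor f b a (E x *v v) * (\<Sum>\<nu>\<in>UNIV. dE x b \<nu> \<rho> * v $ \<nu>)) * E x $ a $ \<sigma>)"
    using assms by (simp add: pd_sum pd_mult d E_differentiable pd_base_comp pd_f_differentiable
        dE_def fund_tensor_def)
  finally show ?thesis
    by (simp add: add.commute)
qed

subsection \<open>The spray\<close>

lemma M_mult:
  assumes "x \<in> W"
  shows "E x ** M x = mat 1" "M x ** E x = mat 1"
    "E x *v (M x *v v) = v" "M x *v (E x *v v) = v"
  using assms E_invertible
  by (simp_all add: matrix_inv_right matrix_inv_left matrix_vector_mul_assoc)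

lemma transpose_E_K:
  assumes "x \<in> W"
  shows "transpose (E x) *v (K x a *v (E x *v v)) = curl x a *v v"
proof -
  have "transpose (E x) ** K x a ** E x =
      (transpose (E x) ** transpose (M x)) ** curl x a ** (M x ** E x)"
    by (simp add: K_def matrix_mul_assoc)
  also have "\<dots> = curl x a"
    using assms by (simp add: M_mult matrix_transpose_mul[symmetric] transpose_mat)
  finally show ?thesis
    by (simp add: matrix_vector_mul_assoc matrix_mul_assoc)
qed

text \<open>This is where coordinate derivatives of the coframe turn into commutation coefficients:
  the contracted index becomes a frame index, and a single factor \<open>E\<close> remains. The
  spray uses it contracted with y_q, the connection uses it as it stands.\<close>

lemma curl_E:
  assumes "x \<in> W"
  shows "(curl x a *v v) $ \<sigma> = (\<Sum>k\<in>UNIV. E x $ k $ \<sigma> * (\<Sum>n\<in>UNIV. K x a $ k $ n * (E x *v v) $ n))"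
  unfolding transpose_E_K[OF assms, symmetric] transpose_vector_mult_nth
  by (simp add: matrix_vector_mult_nth)

text \<open>Before the index is raised, the bracket in the spray is
  \<open>transpose (E x) *v (metric w *v Q + R)\<close>, with \<open>Q\<close> quadratic in
  \<open>v\<close> and \<open>R\<close> holding the commutation coefficients. The inverse metric in
  coordinates first cancels the transposed coframe and then the metric in front of \<open>Q\<close>,
  so only \<open>R\<close> keeps a factor g^{lk}.\<close>

lemma spray_formula:
  assumes x: "x \<in> W" and v: "E x *v v \<in> S"
  defines "w \<equiv> E x *v v"
  shows "spray F \<mu> x v = (1/2) * (\<Sum>l\<in>UNIV. M x $ \<mu> $ l *
    ((\<Sum>k\<in>UNIV. \<Sum>q\<in>UNIV. \<Sum>n\<in>UNIV. inv_metric f l k w * pd q f w * w $ n * K x q $ k $ n) +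
     (\<Sum>d\<in>UNIV. \<Sum>\<rho>\<in>UNIV. dE x l d \<rho> * v $ d * v $ \<rho>)))"
proof -
  define Q :: "real^'m" where "Q = (\<chi> b. \<Sum>d\<in>UNIV. \<Sum>\<rho>\<in>UNIV. dE x b d \<rho> * v $ d * v $ \<rho>)"
  define R :: "real^'m" where
    "R = (\<chi> k. \<Sum>q\<in>UNIV. \<Sum>n\<in>UNIV. pd q f w * w $ n * K x q $ k $ n)"
  define N where "N = matrix_inv (metric w)"
  have w: "w \<in> S"
    using v by (simp add: w_def)
  have 1: "(\<Sum>\<rho>\<in>UNIV. pd \<rho> (\<lambda>z. pd \<sigma> (F z) v) x * v $ \<rho>) - pd \<sigma> (\<lambda>z. F z v) x =
      (transpose (E x) *v (metric w *v Q + R)) $ \<sigma>" for \<sigma>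
  proof -
    have "(\<Sum>\<rho>\<in>UNIV. pd \<rho> (\<lambda>z. pd \<sigma> (F z) v) x * v $ \<rho>) - pd \<sigma> (\<lambda>z. F z v) x =
      (\<Sum>\<rho>\<in>UNIV. \<Sum>a\<in>UNIV. \<Sum>b\<in>UNIV. \<Sum>d\<in>UNIV.
          fund_tensor f b a w * (dE x b d \<rho> * v $ d) * E x $ a $ \<sigma> * v $ \<rho>) +
      ((\<Sum>\<rho>\<in>UNIV. \<Sum>a\<in>UNIV. pd a f w * dE x a \<sigma> \<rho> * v $ \<rho>) -
       (\<Sum>a\<in>UNIV. \<Sum>\<rho>\<in>UNIV. pd a f w * (dE x a \<rho> \<sigma> * v $ \<rho>)))"
      by (simp add: pd_base_pd_F[OF x v] pd_base_F[OF x v] w_def[symmetric] sum.distrib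
          distrib_right sum_distrib_left sum_distrib_right)
    also have "(\<Sum>\<rho>\<in>UNIV. \<Sum>a\<in>UNIV. \<Sum>b\<in>UNIV. \<Sum>d\<in>UNIV.
          fund_tensor f b a w * (dE x b d \<rho> * v $ d) * E x $ a $ \<sigma> * v $ \<rho>) =
        (\<Sum>a\<in>UNIV. \<Sum>b\<in>UNIV. \<Sum>d\<in>UNIV. \<Sum>\<rho>\<in>UNIV.
          fund_tensor f b a w * (dE x b d \<rho> * v $ d) * E x $ a $ \<sigma> * v $ \<rho>)"
      by (subst sum.swap, rule sum.cong[OF refl], subst sum.swap, rule sum.cong[OF refl],
          rule sum.swap)
    also have "\<dots> = (\<Sum>a\<in>UNIV. E x $ a $ \<sigma> * (metric w *v Q) $ a)"
      by (simp add: Q_def matrix_vector_mult_def sum_distrib_left fund_tensor_commute[OF w] mult_ac)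
    \<comment> \<open>The two sums differ by the exchange of \<open>\<sigma>\<close> and
      \<open>\<rho>\<close> in the derivative of the coframe, so their difference is the curl
      contracted with \<open>v\<close>.\<close>
    also have "(\<Sum>\<rho>\<in>UNIV. \<Sum>a\<in>UNIV. pd a f w * dE x a \<sigma> \<rho> * v $ \<rho>) -
        (\<Sum>a\<in>UNIV. \<Sum>\<rho>\<in>UNIV. pd a f w * (dE x a \<rho> \<sigma> * v $ \<rho>)) =
        (\<Sum>a\<in>UNIV. pd a f w * (curl x a *v v) $ \<sigma>)"
      by (subst sum.swap)
        (simp add: curl_def matrix_vector_mult_def sum_subtractf sum_distrib_left algebra_simps)
    also have "\<dots> = (\<Sum>q\<in>UNIV. \<Sum>k\<in>UNIV. \<Sum>n\<in>UNIV. pd q f w * (E x $ k $ \<sigma> * (K x q $ k $ n * w $ n)))"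
      by (simp add: curl_E[OF x] w_def[symmetric] sum_distrib_left)
    also have "\<dots> = (\<Sum>k\<in>UNIV. E x $ k $ \<sigma> * R $ k)"
      by (subst sum.swap) (simp add: R_def sum_distrib_left mult_ac)
    finally show ?thesis
      by (simp add: transpose_vector_mult_nth sum.distrib distrib_left del: transpose_matrix_vector)
  qed
  have "inv_metric (F x) \<mu> \<sigma> v = (M x ** N ** transpose (M x)) $ \<mu> $ \<sigma>" for \<sigma>
    by (simp add: inv_metric_F[OF x v] w_def N_def)
  then have "spray F \<mu> x v = (1/2) * ((M x ** N ** transpose (M x)) *v
      (transpose (E x) *v (metric w *v Q + R))) $ \<mu>"
    by (simp only: spray_def 1 matrix_vector_mult_nth[of "M x ** N ** transpose (M x)"])
  also have "(M x ** N ** transpose (M x)) *v (transpose (E x) *v (metric w *v Q + R)) =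
      (M x ** N ** (transpose (M x) ** transpose (E x))) *v (metric w *v Q + R)"
    by (simp add: matrix_vector_mul_assoc matrix_mul_assoc del: transpose_matrix_vector)
  also have "transpose (M x) ** transpose (E x) = mat 1"
    using x by (simp add: M_mult matrix_transpose_mul[symmetric] transpose_mat)
  also have "(M x ** N ** mat 1) *v (metric w *v Q + R) = M x *v ((N ** metric w) *v Q + N *v R)"
    by (simp add: matrix_vector_mul_assoc[symmetric] matrix_vector_right_distrib)
  also have "\<dots> = M x *v (Q + N *v R)"
    using w by (simp add: N_def matrix_inv_left f_nondegenerate)
  finally show ?thesis
    by (simp add: matrix_vector_mult_def Q_def R_def N_def inv_metric_def sum_distrib_left
        mult_ac add.commute)
qed

subsection \<open>The non-linear connection\<close>

text \<open>Differentiating g^{lk} y_q y^n through \<open>w = E x *v y\<close> yields the Cartan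
  term and the first two terms with factor 1/2. The quadratic part contributes (e^l_{alpha,rho} +
  e^l_{rho,alpha}) y^rho, which is 2 e^l_{rho,alpha} y^rho plus a curl. Halving leaves the first
  term of the bracket without a factor, and half the curl is the term with the Kronecker
  deltas.\<close>

lemma nonlinear_connection_formula:
  assumes x: "x \<in> W" and y: "E x *v y \<in> S"
  defines "w \<equiv> E x *v y"
  shows "nonlinear_connection F \<mu> \<alpha> x y = (\<Sum>l\<in>UNIV. \<Sum>b\<in>UNIV. M x $ \<mu> $ l * E x $ b $ \<alpha> *
    ((\<Sum>\<rho>\<in>UNIV. \<Sum>\<eta>\<in>UNIV. dE x l \<rho> \<eta> * M x $ \<eta> $ b * y $ \<rho>) +
     (\<Sum>q\<in>UNIV. \<Sum>k\<in>UNIV. \<Sum>n\<in>UNIV. K x q $ k $ n *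
        (- cartan_up f l k b w * pd q f w * w $ n +
         (1/2) * (inv_metric f l k w * fund_tensor f q b w * w $ n +
           inv_metric f l k w * pd q f w * (if n = b then 1 else 0) +
           (if l = q then 1 else 0) * (if k = b then 1 else 0) * w $ n)))))"
proof -
  \<comment> \<open>\<open>T\<close> is a function of the frame components, \<open>Q\<close> below
    of the coordinate components: the chain rule through \<open>E x\<close> then concerns
    \<open>T\<close> alone.\<close>
  define T where "T = (\<lambda>l w. \<Sum>k\<in>UNIV. \<Sum>q\<in>UNIV. \<Sum>n\<in>UNIV.
    inv_metric f l k w * pd q f w * w $ n * K x q $ k $ n)"
  define dT where "dT = (\<lambda>l b. \<Sum>k\<in>UNIV. \<Sum>q\<in>UNIV. \<Sum>n\<in>UNIV.
    (- 2 * cartan_up f l k b w * pd q f w * w $ n + inv_metric f l k w * fund_tensor f q b w * w $ n +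
     inv_metric f l k w * pd q f w * (if n = b then 1 else 0)) * K x q $ k $ n)"
  define Q where "Q = (\<lambda>l (v::real^'m). \<Sum>d\<in>UNIV. \<Sum>\<rho>\<in>UNIV. dE x l d \<rho> * v $ d * v $ \<rho>)"
  have w: "w \<in> S"
    using y by (simp add: w_def)
  note [simp] = inv_metric_differentiable[OF w] pd_f_differentiable[OF w]
    bounded_linear_imp_differentiable[OF bounded_linear_vec_nth]
  have T_diff: "T l differentiable (at w)" for l
    by (simp add: T_def)
  have pd_T: "pd b (T l) w = dT l b" for l b
    by (simp add: T_def dT_def pd_sum pd_mult_const pd_mult pd_vec_nth pd_inv_metric[OF w]
        fund_tensor_commute[OF w, of _ b] fund_tensor_def[symmetric])
      (simp add: algebra_simps eq_commute)
  have Q_diff: "Q l differentiable (at y)" for l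
    by (simp add: Q_def)
  have pd_Q: "pd \<alpha> (Q l) y = (\<Sum>\<rho>\<in>UNIV. dE x l \<alpha> \<rho> * y $ \<rho>) + (\<Sum>\<rho>\<in>UNIV. dE x l \<rho> \<alpha> * y $ \<rho>)" for l
  proof -
    have "pd \<alpha> (Q l) y = (\<Sum>d\<in>UNIV. \<Sum>\<rho>\<in>UNIV. dE x l d \<rho> * y $ d * (if \<alpha> = \<rho> then 1 else 0)) +
        (\<Sum>d\<in>UNIV. \<Sum>\<rho>\<in>UNIV. dE x l d \<rho> * (if \<alpha> = d then 1 else 0) * y $ \<rho>)"
      by (simp add: Q_def pd_sum pd_mult pd_cmult pd_vec_nth sum.distrib)
    also have "(\<Sum>d\<in>UNIV. \<Sum>\<rho>\<in>UNIV. dE x l d \<rho> * (if \<alpha> = d then 1 else 0) * y $ \<rho>) =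
        (\<Sum>\<rho>\<in>UNIV. dE x l \<alpha> \<rho> * y $ \<rho>)"
      by (subst sum.swap) (simp add: if_distrib[of "\<lambda>t. _ * t"] if_distrib[of "\<lambda>t. t * _"] cong: if_cong)
    finally show ?thesis
      by (simp add: if_distrib[of "\<lambda>t. _ * t"] cong: if_cong)
  qed
  have curl: "(\<Sum>\<rho>\<in>UNIV. dE x l \<alpha> \<rho> * y $ \<rho>) - (\<Sum>\<rho>\<in>UNIV. dE x l \<rho> \<alpha> * y $ \<rho>) =
      (\<Sum>b\<in>UNIV. E x $ b $ \<alpha> * (\<Sum>n\<in>UNIV. K x l $ b $ n * w $ n))" for l
    using curl_E[OF x, of l y \<alpha>]
    by (simp add: w_def curl_def matrix_vector_mult_def[of "\<chi> i j. _ i j"] sum_subtractf left_diff_distrib)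
  \<comment> \<open>Inserting \<open>M x ** E x = mat 1\<close> produces the factor e^b_alpha that
    all terms of the connection share.\<close>
  have half_Q: "(\<Sum>\<rho>\<in>UNIV. dE x l \<rho> \<alpha> * y $ \<rho>) =
      (\<Sum>b\<in>UNIV. E x $ b $ \<alpha> * (\<Sum>\<rho>\<in>UNIV. \<Sum>\<eta>\<in>UNIV. dE x l \<rho> \<eta> * M x $ \<eta> $ b * y $ \<rho>))" for l
  proof -
    have "(\<Sum>b\<in>UNIV. E x $ b $ \<alpha> * (\<Sum>\<rho>\<in>UNIV. \<Sum>\<eta>\<in>UNIV. dE x l \<rho> \<eta> * M x $ \<eta> $ b * y $ \<rho>)) =
      (\<Sum>\<rho>\<in>UNIV. \<Sum>\<eta>\<in>UNIV. dE x l \<rho> \<eta> * y $ \<rho> * (\<Sum>b\<in>UNIV. M x $ \<eta> $ b * E x $ b $ \<alpha>))"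
      by (simp add: sum_distrib_left, subst sum.swap, rule sum.cong[OF refl], subst sum.swap)
        (simp add: mult_ac)
    also have "\<dots> = (\<Sum>\<rho>\<in>UNIV. \<Sum>\<eta>\<in>UNIV. dE x l \<rho> \<eta> * y $ \<rho> * (M x ** E x) $ \<eta> $ \<alpha>)"
      by (simp add: matrix_matrix_mult_def)
    also have "\<dots> = (\<Sum>\<rho>\<in>UNIV. dE x l \<rho> \<alpha> * y $ \<rho>)"
      by (simp add: M_mult[OF x] mat_def if_distrib cong: if_cong)
    finally show ?thesis
      by simp
  qed
  have lin: "(\<Sum>b\<in>UNIV. r b * (s b + ((1/2) * t b + (1/2) * u b))) =
      (\<Sum>b\<in>UNIV. r b * s b) + ((1/2) * (\<Sum>b\<in>UNIV. r b * t b) + (1/2) * (\<Sum>b\<in>UNIV. r b * u b))"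
    for r s t u :: "'m \<Rightarrow> real"
    by (simp add: distrib_left sum.distrib sum_divide_distrib)
  have coeff: "(1/2) * dT l b + (1/2) * (\<Sum>n\<in>UNIV. K x l $ b $ n * w $ n) =
      (\<Sum>q\<in>UNIV. \<Sum>k\<in>UNIV. \<Sum>n\<in>UNIV. K x q $ k $ n *
        (- cartan_up f l k b w * pd q f w * w $ n +
         (1/2) * (inv_metric f l k w * fund_tensor f q b w * w $ n +
           inv_metric f l k w * pd q f w * (if n = b then 1 else 0) +
           (if l = q then 1 else 0) * (if k = b then 1 else 0) * w $ n)))" for l b
  proof -
    \<comment> \<open>Read from right to left: the sums over \<open>q\<close> and \<open>k\<close>
      are reintroduced with Kronecker deltas so that half the curl fits under the same triple sum as
      \<open>dT\<close>.\<close>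
    have 1: "(\<Sum>q\<in>UNIV. \<Sum>k\<in>UNIV. \<Sum>n\<in>UNIV. K x q $ k $ n *
          ((if l = q then 1 else 0) * (if k = b then 1 else 0) * w $ n)) = (\<Sum>n\<in>UNIV. K x l $ b $ n * w $ n)"
    proof -
      have "(\<Sum>q\<in>UNIV. \<Sum>k\<in>UNIV. \<Sum>n\<in>UNIV. K x q $ k $ n *
          ((if l = q then 1 else 0) * (if k = b then 1 else 0) * w $ n)) =
        (\<Sum>q\<in>UNIV. (if l = q then 1 else 0) * (\<Sum>k\<in>UNIV. (if k = b then 1 else 0) *
          (\<Sum>n\<in>UNIV. K x q $ k $ n * w $ n)))"
        by (simp only: sum_distrib_left mult_ac)
      then show ?thesis
        by (simp add: if_distrib[of "\<lambda>t. t * _"] cong: if_cong)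
    qed
    have "dT l b = (\<Sum>q\<in>UNIV. \<Sum>k\<in>UNIV. \<Sum>n\<in>UNIV. K x q $ k $ n *
        (- 2 * cartan_up f l k b w * pd q f w * w $ n + inv_metric f l k w * fund_tensor f q b w * w $ n +
         inv_metric f l k w * pd q f w * (if n = b then 1 else 0)))"
      unfolding dT_def by (subst sum.swap) (simp add: mult.commute)
    moreover have "(1/2) * (\<Sum>q\<in>UNIV. \<Sum>k\<in>UNIV. \<Sum>n\<in>UNIV. t q k n * r q k n) +
        (1/2) * (\<Sum>q\<in>UNIV. \<Sum>k\<in>UNIV. \<Sum>n\<in>UNIV. t q k n * s q k n) =
        (\<Sum>q\<in>UNIV. \<Sum>k\<in>UNIV. \<Sum>n\<in>UNIV. t q k n * ((1/2) * (r q k n + s q k n)))"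
      for t r s :: "'m \<Rightarrow> 'm \<Rightarrow> 'm \<Rightarrow> real"
      by (simp add: sum_divide_distrib sum.distrib distrib_left add_divide_distrib)
    moreover have "(1/2) * (- 2 * r * s * t + p + q + u) = - r * s * t + (1/2) * (p + q + u)"
      for r s t p q u :: real
      by (simp add: field_simps)
    ultimately show ?thesis
      unfolding 1[symmetric] by (simp only:)
  qed
  have "nonlinear_connection F \<mu> \<alpha> x y =
      pd \<alpha> (\<lambda>v. (1/2) * (\<Sum>l\<in>UNIV. M x $ \<mu> $ l * (T l (E x *v v) + Q l v))) y"
    unfolding nonlinear_connection_def T_def Q_def using spray_formula[OF x] y
    by (intro pd_cong_open[OF open_fibre]) auto
  also have "\<dots> = (1/2) * (\<Sum>l\<in>UNIV. M x $ \<mu> $ l * ((\<Sum>b\<in>UNIV. dT l b * E x $ b $ \<alpha>) + pd \<alpha> (Q l) y))"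
    using T_diff pd_T Q_diff unfolding w_def
    by (subst pd_cmult) (simp_all add: pd_cmult pd_sum pd_add pd_comp_matrix differentiable_comp_matrix)
  also have "\<dots> = (\<Sum>l\<in>UNIV. M x $ \<mu> $ l * (\<Sum>b\<in>UNIV. E x $ b $ \<alpha> *
      ((\<Sum>\<rho>\<in>UNIV. \<Sum>\<eta>\<in>UNIV. dE x l \<rho> \<eta> * M x $ \<eta> $ b * y $ \<rho>) +
       ((1/2) * dT l b + (1/2) * (\<Sum>n\<in>UNIV. K x l $ b $ n * w $ n)))))"
  proof -
    have half: "(1/2) * ((\<Sum>b\<in>UNIV. dT l b * E x $ b $ \<alpha>) + pd \<alpha> (Q l) y) = (\<Sum>b\<in>UNIV. E x $ b $ \<alpha> *
      ((\<Sum>\<rho>\<in>UNIV. \<Sum>\<eta>\<in>UNIV. dE x l \<rho> \<eta> * M x $ \<eta> $ b * y $ \<rho>) +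
       ((1/2) * dT l b + (1/2) * (\<Sum>n\<in>UNIV. K x l $ b $ n * w $ n))))" (is "?lhs = _") for l
    proof -
      have "?lhs = (\<Sum>\<rho>\<in>UNIV. dE x l \<rho> \<alpha> * y $ \<rho>) + ((1/2) * (\<Sum>b\<in>UNIV. E x $ b $ \<alpha> * dT l b) +
          (1/2) * ((\<Sum>\<rho>\<in>UNIV. dE x l \<alpha> \<rho> * y $ \<rho>) - (\<Sum>\<rho>\<in>UNIV. dE x l \<rho> \<alpha> * y $ \<rho>)))"
        by (simp add: pd_Q field_simps)
      then show ?thesis
        by (simp only: lin curl[symmetric] half_Q[symmetric])
    qed
    show ?thesis
      unfolding half[symmetric] by (simp only: sum_distrib_left[of "1/2"] mult.left_commute[of "1/2"])
  qed
  also have "\<dots> = (\<Sum>l\<in>UNIV. \<Sum>b\<in>UNIV. M x $ \<mu> $ l * E x $ b $ \<alpha> *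
      ((\<Sum>\<rho>\<in>UNIV. \<Sum>\<eta>\<in>UNIV. dE x l \<rho> \<eta> * M x $ \<eta> $ b * y $ \<rho>) +
       ((1/2) * dT l b + (1/2) * (\<Sum>n\<in>UNIV. K x l $ b $ n * w $ n))))"
    by (simp add: sum_distrib_left mult.assoc)
  finally show ?thesis
    by (simp only: coeff)
qed

subsection \<open>The commutation coefficients\<close>

lemma M_differentiable:
  assumes "x \<in> W"
  shows "(\<lambda>z. M z $ \<mu> $ a) differentiable (at x)"
  using E_differentiable[OF assms] E_invertible
  by (intro differentiable_matrix_inv[OF _ open_W assms]) auto

text \<open>The minus sign in the derivative of the inverse matrix reverses the two terms of the
  bracket. This fixes the sign of \<open>curl\<close> as e^a_{mu,nu} - e^a_{nu,mu}.\<close>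

lemma lie_bracket_M:
  assumes x: "x \<in> W"
  shows "lie_bracket (\<lambda>z. \<chi> \<mu>. M z $ \<mu> $ a) (\<lambda>z. \<chi> \<mu>. M z $ \<mu> $ b) x =
    M x *v (\<chi> d. K x d $ a $ b)"
proof -
  have D: "frechet_derivative (\<lambda>z. \<chi> \<mu>. M z $ \<mu> $ a) (at x) h $ \<mu> =
      - (\<Sum>d\<in>UNIV. M x $ \<mu> $ d * (\<Sum>\<nu>\<in>UNIV. \<Sum>\<rho>\<in>UNIV. dE x d \<nu> \<rho> * M x $ \<nu> $ a * h $ \<rho>))" for a h \<mu>
  proof -
    have d: "(\<lambda>z. \<chi> \<mu>. M z $ \<mu> $ a) differentiable (at x)"
      using M_differentiable[OF x] by (intro differentiable_vec) simp
    have "frechet_derivative (\<lambda>z. \<chi> \<mu>. M z $ \<mu> $ a) (at x) h $ \<mu> =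
        frechet_derivative (\<lambda>z. M z $ \<mu> $ a) (at x) h"
      using fun_cong[OF frechet_derivative_at[OF frechet_derivative_vec_nth[OF d, of \<mu>]], of h] by simp
    also have "\<dots> = (\<Sum>\<rho>\<in>UNIV. h $ \<rho> * pd \<rho> (\<lambda>z. M z $ \<mu> $ a) x)"
      by (rule frechet_derivative_eq_sum_pd[OF M_differentiable[OF x]])
    also have "\<dots> = (\<Sum>\<rho>\<in>UNIV. \<Sum>d\<in>UNIV. \<Sum>\<nu>\<in>UNIV. - (h $ \<rho> * (M x $ \<mu> $ d * dE x d \<nu> \<rho> * M x $ \<nu> $ a)))"
      using E_differentiable[OF x] E_invertible
      by (simp add: pd_matrix_inv[OF _ open_W x] dE_def sum_distrib_left sum_negf)
    also have "\<dots> = (\<Sum>d\<in>UNIV. \<Sum>\<nu>\<in>UNIV. \<Sum>\<rho>\<in>UNIV. - (h $ \<rho> * (M x $ \<mu> $ d * dE x d \<nu> \<rho> * M x $ \<nu> $ a)))"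
      by (subst sum.swap, rule sum.cong[OF refl], rule sum.swap)
    finally show ?thesis
      by (simp add: sum_distrib_left sum_negf mult_ac)
  qed
  have K: "K x d $ a $ b = (\<Sum>\<nu>\<in>UNIV. \<Sum>\<rho>\<in>UNIV. dE x d \<nu> \<rho> * M x $ \<nu> $ a * M x $ \<rho> $ b) -
      (\<Sum>\<nu>\<in>UNIV. \<Sum>\<rho>\<in>UNIV. dE x d \<nu> \<rho> * M x $ \<nu> $ b * M x $ \<rho> $ a)" for d
  proof -
    have "K x d $ a $ b =
        (\<Sum>\<rho>\<in>UNIV. \<Sum>\<nu>\<in>UNIV. dE x d \<nu> \<rho> * M x $ \<nu> $ a * M x $ \<rho> $ b) -
        (\<Sum>\<rho>\<in>UNIV. \<Sum>\<nu>\<in>UNIV. dE x d \<rho> \<nu> * M x $ \<nu> $ a * M x $ \<rho> $ b)"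
      by (simp add: K_def curl_def matrix_matrix_mult_def transpose_def sum_distrib_right
          sum_distrib_left sum_subtractf left_diff_distrib right_diff_distrib mult_ac)
    also have "(\<Sum>\<rho>\<in>UNIV. \<Sum>\<nu>\<in>UNIV. dE x d \<nu> \<rho> * M x $ \<nu> $ a * M x $ \<rho> $ b) =
        (\<Sum>\<nu>\<in>UNIV. \<Sum>\<rho>\<in>UNIV. dE x d \<nu> \<rho> * M x $ \<nu> $ a * M x $ \<rho> $ b)"
      by (rule sum.swap)
    finally show ?thesis
      by (simp add: mult_ac)
  qed
  show ?thesis
    by (simp add: vec_eq_iff lie_bracket_def D K matrix_vector_mult_def sum_subtractf algebra_simps)
qed

end

section \<open>Charts and tangent vectors\<close>

context
  fixes A :: "('p::{t2_space,second_countable_topology}, 'm::finite) chart set"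
  assumes atlas: "smooth_atlas A"
begin

lemma
  assumes "c \<in> A"
  shows open_chart_domain: "open (fst c)"
    and point_of_chart: "p \<in> fst c \<Longrightarrow> point_of c (snd c p) = p"
  using assms atlas by (auto simp: smooth_atlas_def homeomorphism_def)

lemma open_chart_image:
  assumes "c \<in> A" "open V"
  shows "open (snd c ` (V \<inter> fst c))"
proof -
  have h: "homeomorphism (fst c) (snd c ` fst c) (snd c) (point_of c)" "open (snd c ` fst c)"
    using assms(1) atlas by (auto simp: smooth_atlas_def)
  have "openin (top_of_set (snd c ` fst c)) (snd c ` (V \<inter> fst c))"
    using openin_open_Int[OF assms(2), of "fst c"]
    by (intro homeomorphism_imp_open_map[OF h(1)]) (simp add: Int_commute)
  then show ?thesis
    using h(2) openin_open_trans by blast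
qed

lemma chart_image_point:
  assumes "c \<in> A" "z \<in> snd c ` (V \<inter> fst c)"
  shows "point_of c z \<in> V" "point_of c z \<in> fst c" "snd c (point_of c z) = z"
  using assms(2) point_of_chart[OF assms(1)] by auto

lemma coordinate_change_differentiable:
  assumes "c \<in> A" "c' \<in> A" "p \<in> fst c" "p \<in> fst c'"
  shows "(snd c' \<circ> point_of c) differentiable (at (snd c p))"
proof -
  have "Ck_on 1 (snd c ` (fst c \<inter> fst c')) (snd c' \<circ> point_of c)"
    using atlas assms by (simp add: smooth_atlas_def del: Ck_on.simps One_nat_def)
  then show ?thesis
    using assms by simp
qed

lemma linear_transition:
  assumes "c \<in> A" "c' \<in> A" "p \<in> fst c" "p \<in> fst c'"
  shows "linear (transition c c' p)"
  unfolding transition_def using linear_frechet_derivative coordinate_change_differentiable[OF assms] by blast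

text \<open>Chain rule, since near \<open>snd c p\<close> the change from \<open>c\<close> to
  \<open>c''\<close> factors through \<open>c'\<close>. This cocycle property is what makes
  \<open>coord_vec\<close> satisfy the transformation law of tangent vectors.\<close>

lemma transition_trans:
  assumes c: "c \<in> A" "c' \<in> A" "c'' \<in> A" and p: "p \<in> fst c" "p \<in> fst c'" "p \<in> fst c''"
  shows "transition c' c'' p (transition c c' p y) = transition c c'' p y"
proof -
  have 1: "(snd c' \<circ> point_of c) (snd c p) = snd c' p"
    using assms point_of_chart by simp
  have "open (snd c ` (fst c' \<inter> fst c))"
    using c open_chart_image open_chart_domain by blast
  then have "frechet_derivative (snd c'' \<circ> point_of c) (at (snd c p)) =
      frechet_derivative ((snd c'' \<circ> point_of c') \<circ> (snd c' \<circ> point_of c)) (at (snd c p))"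
    by (rule frechet_derivative_cong_open)
      (use p point_of_chart[OF c(1)] point_of_chart[OF c(2)] in auto)
  also have "\<dots> = frechet_derivative (snd c'' \<circ> point_of c') (at (snd c' p)) \<circ>
      frechet_derivative (snd c' \<circ> point_of c) (at (snd c p))"
    using frechet_derivative_compose[of "snd c' \<circ> point_of c" "snd c p" "snd c'' \<circ> point_of c'"]
      coordinate_change_differentiable assms unfolding 1 by blast
  finally show ?thesis
    by (simp add: transition_def)
qed

lemma coord_vec_in_tangent_space:
  assumes "c \<in> A" "p \<in> fst c"
  shows "coord_vec A c p y \<in> tangent_space A p"
  by (simp add: coord_vec_def tangent_space_def transition_trans[OF assms(1) _ _ assms(2)])

lemma coord_vec_tangent_space:
  assumes "c \<in> A" "p \<in> fst c" "v \<in> tangent_space A p"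
  shows "coord_vec A c p (v c) = v"
proof
  fix c'
  have "v c' = transition c c' p (v c)" if "c' \<in> A" "p \<in> fst c'"
    using assms that unfolding tangent_space_def by blast
  moreover have "v c' = 0" if "\<not> (c' \<in> A \<and> p \<in> fst c')"
    using assms(3) that unfolding tangent_space_def by blast
  ultimately show "coord_vec A c p (v c) c' = v c'"
    by (cases "c' \<in> A \<and> p \<in> fst c'") (auto simp: coord_vec_def)
qed

lemma
  assumes "c \<in> A" "p \<in> fst c"
  shows coord_vec_add: "coord_vec A c p (y + z) = (\<lambda>c'. coord_vec A c p y c' + coord_vec A c p z c')"
    and coord_vec_scaleR: "coord_vec A c p (r *\<^sub>R y) = (\<lambda>c'. r *\<^sub>R coord_vec A c p y c')"
  using linear_add[OF linear_transition[OF assms(1) _ assms(2)]]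
    linear_cmul[OF linear_transition[OF assms(1) _ assms(2)]]
  by (simp_all add: coord_vec_def fun_eq_iff)

end

section \<open>Components with respect to a basis\<close>

lemma basis_comb_axis:
  fixes B :: "'m::finite \<Rightarrow> 'v::real_vector"
  shows "(\<Sum>a\<in>UNIV. (axis b 1 :: real^'m) $ a *\<^sub>R B a) = B b"
  by (simp add: axis_def if_distrib[of "\<lambda>t. t *\<^sub>R _"] cong: if_cong)

lemma
  fixes B :: "'m::finite \<Rightarrow> 'v::euclidean_space"
  assumes "is_basis B"
  shows linear_basis_comb: "linear (\<lambda>w::real^'m. \<Sum>a\<in>UNIV. w $ a *\<^sub>R B a)"
    and bij_basis_comb: "bij (\<lambda>w::real^'m. \<Sum>a\<in>UNIV. w $ a *\<^sub>R B a)"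
proof -
  let ?\<beta> = "\<lambda>w::real^'m. \<Sum>a\<in>UNIV. w $ a *\<^sub>R B a"
  show lin: "linear ?\<beta>"
    by (intro linearI) (simp_all add: scaleR_add_left sum.distrib scaleR_sum_right)
  have B: "inj B" "independent (range B)" "span (range B) = UNIV"
    using assms by (auto simp: is_basis_def)
  have "w = 0" if "?\<beta> w = 0" for w
  proof -
    have "(\<Sum>v\<in>range B. w $ (inv B v) *\<^sub>R v) = 0"
      using that B(1) by (simp add: sum.reindex)
    then have "w $ (inv B v) = 0" if "v \<in> range B" for v
      using B(2) that by (intro independentD[where s = "range B" and v = v]) auto
    then show ?thesis
      using B(1) by (metis inv_f_f rangeI vec_eq_iff zero_index)
  qed
  then have "inj ?\<beta>"
    using lin linear_injective_0 by blast
  moreover have "surj ?\<beta>"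
  proof -
    have "span (range B) \<subseteq> range ?\<beta>"
    proof (rule span_minimal)
      show "range B \<subseteq> range ?\<beta>"
      proof
        fix v assume "v \<in> range B"
        then obtain b where "v = B b" by blast
        then have "v = ?\<beta> (axis b 1)"
          by (simp add: basis_comb_axis)
        then show "v \<in> range ?\<beta>" by blast
      qed
      show "subspace (range ?\<beta>)"
        using lin by (simp add: linear_subspace_image)
    qed
    then show ?thesis
      using B(3) by blast
  qed
  ultimately show "bij ?\<beta>"
    by (simp add: bij_def)
qed

lemma hess_linear:
  assumes "Ck_on 4 \<omega> L" "y \<in> \<omega>"
  shows "linear (hess L y u)"
proof -
  have "(\<lambda>z. frechet_derivative L (at z) u) differentiable (at y)"
    using assms by (simp add: eval_nat_numeral)
  then show ?thesis
    using linear_frechet_derivative by (simp add: hess_def[abs_def])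
qed

text \<open>The matrix is the Gram matrix of the Hessian in the basis \<open>B\<close>, so a kernel
  vector gives a vector in the radical. Linearity of \<open>hess\<close> is at hand in the last
  slot, whereas the radical is defined through the other; symmetry of second derivatives bridges the
  two.\<close>

lemma pseudo_Minkowski_nondegenerate:
  fixes B :: "'m::finite \<Rightarrow> 'v::euclidean_space"
  assumes L: "pseudo_Minkowski \<omega> L" and B: "is_basis B"
    and w: "(\<Sum>a\<in>UNIV. w $ a *\<^sub>R B a) \<in> \<omega>"
  shows "invertible (\<chi> i j. fund_tensor (in_basis B L) i j w)"
proof -
  define \<beta> where "\<beta> = (\<lambda>w::real^'m. \<Sum>a\<in>UNIV. w $ a *\<^sub>R B a)"
  have lin: "linear \<beta>" and bij: "bij \<beta>" and ax: "\<beta> (axis b 1) = B b" for b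
    using linear_basis_comb[OF B] bij_basis_comb[OF B] basis_comb_axis by (auto simp: \<beta>_def)
  have \<omega>: "open \<omega>" and C4: "Ck_on 4 \<omega> L" and nd: "(\<And>v. hess L (\<beta> w) u v = 0) \<Longrightarrow> u = 0" for u
    using L w by (auto simp: pseudo_Minkowski_def \<beta>_def)
  have w: "\<beta> w \<in> \<omega>"
    using w by (simp add: \<beta>_def)
  have C2: "Ck_on 2 \<omega> L"
    using C4 by (rule Ck_on_mono[rotated]) simp
  have op: "open (\<beta> -` \<omega>)"
    using \<omega> lin by (simp add: open_vimage linear_continuous_on linear_linear)
  note hess_lin = hess_linear[OF C4 w]
  have sym: "hess L (\<beta> w) u v = hess L (\<beta> w) v u" for u v
    unfolding hess_def using \<omega> w C2 by (rule Ck_on_2_symmetric)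
  have fund: "fund_tensor (in_basis B L) i j w = hess L (\<beta> w) (B j) (B i)" for i j
  proof -
    have d: "L differentiable (at z)" "(\<lambda>z. frechet_derivative L (at z) u) differentiable (at z)"
      if "z \<in> \<omega>" for z u
      using C4 that by (auto simp: eval_nat_numeral)
    have "fund_tensor (in_basis B L) i j w = pd i (\<lambda>w. frechet_derivative L (at (\<beta> w)) (B j)) w"
      unfolding fund_tensor_def
    proof (rule pd_cong_open[OF op])
      show "pd j (in_basis B L) z = frechet_derivative L (at (\<beta> z)) (B j)" if "z \<in> \<beta> -` \<omega>" for z
        using frechet_derivative_comp_linear[OF lin d(1), of z "axis j 1"] that
        by (simp add: pd_def in_basis_def[abs_def] \<beta>_def[symmetric] ax)
          (simp add: \<beta>_def)
    qed (use w in auto)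
    then show ?thesis
      using frechet_derivative_comp_linear[OF lin d(2), of w "B j" "axis i 1"] w
      by (simp add: pd_def hess_def ax)
  qed
  have "u = 0" if u: "(\<chi> i j. fund_tensor (in_basis B L) i j w) *v u = 0" for u
  proof -
    have comb: "hess L (\<beta> w) v (\<beta> u) = (\<Sum>j\<in>UNIV. u $ j * hess L (\<beta> w) v (B j))" for u v
      using hess_lin by (simp add: \<beta>_def linear_sum linear_cmul)
    have "hess L (\<beta> w) (\<beta> u) (B i) = 0" for i
    proof -
      have "hess L (\<beta> w) (\<beta> u) (B i) = (\<Sum>j\<in>UNIV. u $ j * hess L (\<beta> w) (B i) (B j))"
        unfolding sym[of "\<beta> u"] by (rule comb)
      also have "\<dots> = ((\<chi> i j. fund_tensor (in_basis B L) i j w) *v u) $ i"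
        by (simp add: matrix_vector_mult_nth fund sym[of "B i"] mult.commute)
      finally show ?thesis
        using u by simp
    qed
    then have "hess L (\<beta> w) (\<beta> u) (\<beta> v) = 0" for v
      by (simp add: comb)
    then have "\<beta> u = 0"
      using nd bij by (metis bij_pointE)
    then show ?thesis
      using bij lin by (metis bij_is_inj injD linear_0)
  qed
  then show ?thesis
    using matrix_left_invertible_ker invertible_left_inverse by blast
qed

section \<open>The coframe in a chart\<close>

locale modeled_chart =
  fixes A :: "('p::{t2_space,second_countable_topology}, 'm::finite) chart set"
    and \<Omega> :: "('p \<times> ('p, 'm) tvec) set"
    and F :: "'p \<times> ('p, 'm) tvec \<Rightarrow> real"
    and \<omega> :: "'v::euclidean_space set"
    and L :: "'v \<Rightarrow> real"
    and B :: "'m \<Rightarrow> 'v"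
    and U :: "'p set"
    and \<phi> :: "'p \<Rightarrow> ('p, 'm) tvec \<Rightarrow> 'v"
    and c :: "('p, 'm) chart"
  assumes atlas: "smooth_atlas A" and L: "pseudo_Minkowski \<omega> L"
    and triv: "model_triv A \<Omega> F \<omega> L U \<phi>" and B: "is_basis B" and c: "c \<in> A"
begin

abbreviation Z :: "(real^'m) set" where "Z \<equiv> snd c ` (U \<inter> fst c)"

definition E :: "real^'m \<Rightarrow> real^'m^'m" where
  "E z = (\<chi> a \<mu>. coframe A \<phi> B c a \<mu> z)"

definition \<beta> :: "real^'m \<Rightarrow> 'v" where
  "\<beta> w = (\<Sum>a\<in>UNIV. w $ a *\<^sub>R B a)"

definition P :: "real^'m \<Rightarrow> real^'m \<Rightarrow> 'v" where
  "P z y = \<phi> (point_of c z) (coord_vec A c (point_of c z) y)"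

lemma linear_\<beta>: "linear \<beta>" and bij_\<beta>: "bij \<beta>"
  using linear_basis_comb[OF B] bij_basis_comb[OF B] by (simp_all add: \<beta>_def[abs_def])

lemma inv_\<beta>_\<beta> [simp]: "inv \<beta> (\<beta> w) = w" and \<beta>_inv_\<beta> [simp]: "\<beta> (inv \<beta> v) = v"
  by (rule inv_f_f[OF bij_is_inj[OF bij_\<beta>]], rule surj_f_inv_f[OF bij_is_surj[OF bij_\<beta>]])

lemma linear_inv_\<beta>: "linear (inv \<beta>)"
  by (intro linearI; rule injD[OF bij_is_inj[OF bij_\<beta>]])
    (simp_all add: linear_add[OF linear_\<beta>] linear_cmul[OF linear_\<beta>])

lemma in_basis_eq: "in_basis B L = (\<lambda>w. L (\<beta> w))"
  by (simp add: in_basis_def[abs_def] \<beta>_def)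

lemma open_Z: "open Z"
  using open_chart_image[OF atlas c] triv by (simp add: model_triv_def)

lemma Z_point:
  assumes "z \<in> Z"
  shows "point_of c z \<in> U" "point_of c z \<in> fst c"
  using chart_image_point[OF atlas c assms] by auto

lemma \<phi>_iso: "z \<in> Z \<Longrightarrow> linear_iso_on (tangent_space A (point_of c z)) (\<phi> (point_of c z))"
  using triv Z_point by (simp add: model_triv_def)

lemma linear_P:
  assumes "z \<in> Z"
  shows "linear (P z)"
  using \<phi>_iso[OF assms] coord_vec_in_tangent_space[OF atlas c Z_point(2)[OF assms]]
  by (intro linearI)
    (simp_all add: P_def coord_vec_add[OF atlas c Z_point(2)[OF assms]]
      coord_vec_scaleR[OF atlas c Z_point(2)[OF assms]] linear_iso_on_def)

lemma P_frame:
  assumes "z \<in> Z"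
  shows "P z (frame A \<phi> B c a z) = B a"
proof -
  let ?p = "point_of c z"
  have bij: "bij_betw (\<phi> ?p) (tangent_space A ?p) UNIV"
    using \<phi>_iso[OF assms] by (simp add: linear_iso_on_def)
  have "inv_into (tangent_space A ?p) (\<phi> ?p) (B a) \<in> tangent_space A ?p"
    using bij by (simp add: bij_betw_def inv_into_into)
  then show ?thesis
    using bij coord_vec_tangent_space[OF atlas c Z_point(2)[OF assms]]
    by (simp add: P_def frame_def bij_betw_def f_inv_into_f)
qed

text \<open>The coframe is defined by inverting the frame matrix. As \<open>P z\<close>, the
  isomorphism \<open>\<phi>\<close> in coordinates, sends the frame to \<open>B\<close>, that
  inverse is the matrix of \<open>P z\<close> with respect to \<open>B\<close>. The assumptions on
  \<open>\<phi>\<close> thereby become statements about \<open>E\<close>.\<close>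

lemma
  assumes z: "z \<in> Z"
  shows E_vec: "E z *v y = inv \<beta> (P z y)"
    and matrix_inv_E: "matrix_inv (E z) = (\<chi> \<nu> b. frame A \<phi> B c b z $ \<nu>)"
    and invertible_E: "invertible (E z)"
proof -
  define T where "T = matrix (\<lambda>y. inv \<beta> (P z y))"
  let ?N = "\<chi> \<nu> b. frame A \<phi> B c b z $ \<nu>"
  have "linear (\<lambda>y. inv \<beta> (P z y))"
    using linear_compose[OF linear_P[OF z] linear_inv_\<beta>] by (simp add: o_def)
  then have T: "T *v y = inv \<beta> (P z y)" for y
    unfolding T_def using matrix_works linear_matrix_vector_mul_eq by metis
  have "(T ** ?N) $ a $ b = mat 1 $ a $ b" for a b
  proof -
    have "(T ** ?N) $ a $ b = (T *v frame A \<phi> B c b z) $ a"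
      by (simp add: matrix_matrix_mult_def matrix_vector_mult_def)
    also have "T *v frame A \<phi> B c b z = inv \<beta> (\<beta> (axis b 1))"
      by (simp only: T P_frame[OF z]) (simp add: \<beta>_def basis_comb_axis del: inv_\<beta>_\<beta>)
    finally show ?thesis
      by (simp add: mat_def axis_def)
  qed
  then have TN: "T ** ?N = mat 1"
    by (simp add: vec_eq_iff)
  then have NT: "?N ** T = mat 1"
    by (simp add: matrix_left_right_inverse)
  have ET: "E z = T"
    using matrix_inv_eqI[OF NT] by (simp add: E_def coframe_def vec_eq_iff)
  show "E z *v y = inv \<beta> (P z y)"
    by (simp add: ET T)
  show "matrix_inv (E z) = ?N"
    unfolding ET using TN by (rule matrix_inv_eqI)
  show "invertible (E z)"
    unfolding ET using TN NT by (auto simp: invertible_def)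
qed

text \<open>The vectors whose \<open>C^1\<close> dependence \<open>model_triv\<close> demands, the
  images of the coordinate fields, are the columns of \<open>E\<close> up to the fixed linear map
  \<open>\<beta>\<close>.\<close>

lemma E_differentiable:
  assumes z: "z \<in> Z"
  shows "(\<lambda>z. E z $ a $ \<mu>) differentiable (at z)"
proof (rule differentiable_cong_open[OF _ open_Z z])
  have "Ck_on (Suc 0) Z (\<lambda>x. P x (axis \<mu> 1))"
    using triv c by (simp add: model_triv_def P_def[abs_def] del: Ck_on.simps)
  then have "(\<lambda>x. P x (axis \<mu> 1)) differentiable (at z)"
    using z by (rule Ck_on_differentiable)
  moreover have "bounded_linear (inv \<beta>)"
    using linear_inv_\<beta> by (simp add: linear_linear)
  ultimately have "(\<lambda>x. inv \<beta> (P x (axis \<mu> 1))) differentiable (at z)"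
    using differentiable_chain_at[of "\<lambda>x. P x (axis \<mu> 1)" z "inv \<beta>"]
    by (simp add: bounded_linear_imp_differentiable o_def)
  then show "(\<lambda>x. inv \<beta> (P x (axis \<mu> 1)) $ a) differentiable (at z)"
    by (rule differentiable_vec_nth)
  show "inv \<beta> (P x (axis \<mu> 1)) $ a = E x $ a $ \<mu>" if "x \<in> Z" for x
    unfolding E_vec[OF that, symmetric] by (simp add: matrix_vector_mult_basis column_def)
qed

lemma P_eq: "z \<in> Z \<Longrightarrow> P z y = \<beta> (E z *v y)"
  by (simp add: E_vec)

lemma coord_cone_imp:
  assumes "z \<in> Z" "y \<in> coord_cone A \<Omega> c z"
  shows "E z *v y \<in> \<beta> -` \<omega>"
proof -
  have "P z y \<in> \<omega>"
    using assms triv Z_point[OF assms(1)] by (auto simp: P_def model_triv_def coord_cone_def)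
  then show ?thesis
    using assms by (simp add: P_eq)
qed

sublocale modeled_coordinates Z E "\<beta> -` \<omega>" "in_basis B L" "coord_fun A F c"
proof
  have L': "open \<omega>" "Ck_on 4 \<omega> L"
    using L by (simp_all add: pseudo_Minkowski_def)
  show "open Z"
    by (rule open_Z)
  show "open (\<beta> -` \<omega>)"
    using linear_\<beta> L' by (simp add: open_vimage linear_continuous_on linear_linear)
  show "(\<lambda>z. E z $ a $ \<mu>) differentiable (at z)" if "z \<in> Z" for z a \<mu>
    using that by (rule E_differentiable)
  show "invertible (E z)" if "z \<in> Z" for z
    using that by (rule invertible_E)
  show "Ck_on 4 (\<beta> -` \<omega>) (in_basis B L)"
    unfolding in_basis_eq using L'(1) linear_\<beta> L'(2) by (rule Ck_on_comp_linear)
  show "invertible (\<chi> i j. fund_tensor (in_basis B L) i j w)" if "w \<in> \<beta> -` \<omega>" for w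
    using that by (intro pseudo_Minkowski_nondegenerate[OF L B]) (simp add: \<beta>_def)
  show "coord_fun A F c z v = in_basis B L (E z *v v)" if "z \<in> Z" "E z *v v \<in> \<beta> -` \<omega>" for z v
  proof -
    \<comment> \<open>\<open>model_triv\<close> compares \<open>L\<close> with \<open>F\<close> on
      the closure of the cone, which contains the cone itself.\<close>
    have "P z v \<in> closure \<omega>"
      using that closure_subset by (auto simp: P_eq)
    then have "L (P z v) = coord_fun A F c z v"
      using that(1) triv Z_point coord_vec_in_tangent_space[OF atlas c]
      by (simp add: P_def model_triv_def coord_fun_def)
    then show ?thesis
      using that(1) by (simp add: P_eq in_basis_eq)
  qed
qed

text \<open>\<open>C\<close> is given only as coefficients of an expansion in the frame;
  \<open>lie_bracket_M\<close> supplies another, and invertibility of the frame matrix identifies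
  them. Since brackets involve derivatives, the frame must agree with the columns of the inverse of
  \<open>E\<close> on the open set \<open>Z\<close>, not merely at \<open>x\<close>.\<close>

lemma commutation_coefficients:
  assumes comm: "\<And>a b. lie_bracket (frame A \<phi> B c a) (frame A \<phi> B c b) x =
      (\<Sum>d\<in>UNIV. C d a b *\<^sub>R frame A \<phi> B c d x)"
    and x: "x \<in> Z"
  shows "K x d $ a $ b = C d a b"
proof -
  have fr: "(\<chi> \<mu>. matrix_inv (E z) $ \<mu> $ a) = frame A \<phi> B c a z" if "z \<in> Z" for z a
    using that by (simp add: matrix_inv_E vec_eq_iff)
  have "frechet_derivative (\<lambda>z. \<chi> \<mu>. matrix_inv (E z) $ \<mu> $ a) (at x) =
      frechet_derivative (frame A \<phi> B c a) (at x)" for a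
    using open_Z x fr by (rule frechet_derivative_cong_open)
  then have "matrix_inv (E x) *v (\<chi> d. K x d $ a $ b) = (\<Sum>d\<in>UNIV. C d a b *\<^sub>R frame A \<phi> B c d x)"
    using lie_bracket_M[OF x, of a b] comm[of a b] fr[OF x] by (simp add: lie_bracket_def)
  also have "\<dots> = matrix_inv (E x) *v (\<chi> d. C d a b)"
    by (simp add: matrix_inv_E[OF x] matrix_vector_mult_def vec_eq_iff mult.commute)
  finally have "(\<chi> d. K x d $ a $ b) = (\<chi> d. C d a b)"
    using M_mult(3)[OF x] by metis
  then show ?thesis
    by (simp add: vec_eq_iff)
qed

end

theorem mainTheorem3:
  fixes A :: "('p::{t2_space,second_countable_topology}, 'm::finite) chart set"
    and \<Omega> :: "('p \<times> ('p, 'm) tvec) set"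
    and F :: "'p \<times> ('p, 'm) tvec \<Rightarrow> real"
    and \<omega> :: "'v::euclidean_space set"
    and L :: "'v \<Rightarrow> real"
    and B :: "'m \<Rightarrow> 'v"
    and U :: "'p set"
    and \<phi> :: "'p \<Rightarrow> ('p, 'm) tvec \<Rightarrow> 'v"
    and c :: "('p, 'm) chart"
    and cc :: "'m \<Rightarrow> 'm \<Rightarrow> 'm \<Rightarrow> real^'m \<Rightarrow> real"
    and x y w :: "real^'m"
  defines "e \<equiv> (\<lambda>\<mu> a. frame A \<phi> B c a x $ \<mu>)"
    and "ed \<equiv> (\<lambda>a \<mu>. coframe A \<phi> B c a \<mu> x)"
    and "de \<equiv> (\<lambda>a \<mu> \<nu>. pd \<nu> (coframe A \<phi> B c a \<mu>) x)"
    and "C \<equiv> (\<lambda>q k n. cc q k n x)"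
    and "yl \<equiv> (\<lambda>q. pd q (in_basis B L) w)"
    and "g \<equiv> (\<lambda>a b. fund_tensor (in_basis B L) a b w)"
    and "gi \<equiv> (\<lambda>a b. inv_metric (in_basis B L) a b w)"
    and "Cu \<equiv> (\<lambda>l k b. cartan_up (in_basis B L) l k b w)"
    and "\<delta> \<equiv> (\<lambda>i j. if i = j then 1 else 0 :: real)"
  assumes "pseudo_Finsler A \<Omega> F"
    and "pseudo_Minkowski \<omega> L"
    and "modeled_on A \<Omega> F \<omega> L"
    and "model_triv A \<Omega> F \<omega> L U \<phi>"
    and "is_basis B"
    and "c \<in> A"
    and comm: "\<forall>z\<in>snd c ` (U \<inter> fst c). \<forall>a b.
           lie_bracket (frame A \<phi> B c a) (frame A \<phi> B c b) z =
             (\<Sum>d\<in>UNIV. cc d a b z *\<^sub>R frame A \<phi> B c d z)"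
    and "x \<in> snd c ` (U \<inter> fst c)"
    and "y \<in> coord_cone A \<Omega> c x"
    and "\<forall>\<mu>. y $ \<mu> = (\<Sum>a\<in>UNIV. w $ a * e \<mu> a)"
  shows "(\<forall>\<mu>. spray (coord_fun A F c) \<mu> x y =
            (1/2) * (\<Sum>l\<in>UNIV. e \<mu> l *
              ((\<Sum>k\<in>UNIV. \<Sum>q\<in>UNIV. \<Sum>n\<in>UNIV. gi l k * yl q * w $ n * C q k n) +
               (\<Sum>d\<in>UNIV. \<Sum>\<rho>\<in>UNIV. \<Sum>s\<in>UNIV. \<Sum>p\<in>UNIV.
                  de l d \<rho> * e d s * e \<rho> p * w $ s * w $ p))))
       \<and> (\<forall>\<mu> \<alpha>. nonlinear_connection (coord_fun A F c) \<mu> \<alpha> x y =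
            (\<Sum>l\<in>UNIV. \<Sum>b\<in>UNIV. e \<mu> l * ed b \<alpha> *
              ((\<Sum>\<rho>\<in>UNIV. \<Sum>\<eta>\<in>UNIV. \<Sum>p\<in>UNIV. de l \<rho> \<eta> * e \<eta> b * e \<rho> p * w $ p) +
               (\<Sum>q\<in>UNIV. \<Sum>k\<in>UNIV. \<Sum>n\<in>UNIV. C q k n *
                  (- Cu l k b * yl q * w $ n +
                   (1/2) * (gi l k * g q b * w $ n + gi l k * yl q * \<delta> n b + \<delta> l q * \<delta> k b * w $ n))))))"
proof -
  interpret modeled_chart A \<Omega> F \<omega> L B U \<phi> c
    using assms by unfold_locales (auto simp: pseudo_Finsler_def)
  have x: "x \<in> Z" and y: "E x *v y \<in> \<beta> -` \<omega>"
    using assms coord_cone_imp by auto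
  have e: "M x $ \<mu> $ a = e \<mu> a" for a \<mu>
    by (simp add: matrix_inv_E[OF x] e_def)
  have ed: "E x $ a $ \<mu> = ed a \<mu>" for a \<mu>
    by (simp add: ed_def E_def)
  have de: "dE x a \<mu> \<nu> = de a \<mu> \<nu>" for a \<mu> \<nu>
    by (simp add: dE_def de_def E_def)
  have C: "K x q $ k $ n = C q k n" for q k n
    unfolding C_def using comm x by (intro commutation_coefficients) auto
  have y_eq: "y $ \<mu> = (\<Sum>a\<in>UNIV. e \<mu> a * w $ a)" for \<mu>
    using assms by (simp add: mult.commute)
  have "y = M x *v w"
    by (simp add: vec_eq_iff matrix_vector_mult_nth e y_eq)
  then have w: "E x *v y = w"
    using x by (simp add: M_mult)
  \<comment> \<open>The formulas of the locale keep the coordinate components of \<open>y\<close>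
    wherever the coframe is differentiated; expanding these in the frame gives the stated
    form.\<close>
  have "(\<Sum>d\<in>UNIV. \<Sum>\<rho>\<in>UNIV. de l d \<rho> * y $ d * y $ \<rho>) =
      (\<Sum>d\<in>UNIV. \<Sum>\<rho>\<in>UNIV. \<Sum>s\<in>UNIV. \<Sum>p\<in>UNIV. de l d \<rho> * e d s * e \<rho> p * w $ s * w $ p)" for l
    by (simp only: mult.assoc y_eq sum_product) (simp add: sum_distrib_left mult_ac)
  moreover have "(\<Sum>\<rho>\<in>UNIV. \<Sum>\<eta>\<in>UNIV. de l \<rho> \<eta> * e \<eta> b * y $ \<rho>) =
      (\<Sum>\<rho>\<in>UNIV. \<Sum>\<eta>\<in>UNIV. \<Sum>p\<in>UNIV. de l \<rho> \<eta> * e \<eta> b * e \<rho> p * w $ p)" for l b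
    by (simp add: y_eq sum_distrib_left mult.assoc)
  ultimately show ?thesis
    using spray_formula[OF x y] nonlinear_connection_formula[OF x y]
    unfolding w e ed de C yl_def g_def gi_def Cu_def \<delta>_def by simp
qed

end
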